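(* Let $\Gamma$ be an abelian group, let $E$ be a graded division ring with $\Gamma_E\subseteq\Gamma$, and let $S=\mathbb M_n(E)(\overline\delta)$, where $\overline\delta=(\delta_1,\dots,\delta_n)$ with $\delta_i\in\Gamma$. Then there is a (Dieudonné determinant) group homomorphism $$\det\nolimits_E\colon S_h^*=\mathrm{GL}_n^h(E)(\overline\delta)\longrightarrow E_h^*/[E_h^*,E_h^*]$$ such that, if $A\in S_h^*$ has strict Bruhat decomposition $A=TUP_\pi V$ with $U=\mathrm{diag}(u_1,\dots,u_n)$, then $$\det\nolimits_E(A)=\mathrm{sgn}(\pi)\,u_1\cdots u_n\,[E_h^*,E_h^*].$$ Moreover, if $\det_0\colon S_0^*\to E_0^*/[E_0^*,E_0^*]$ is the Dieudonné determinant for the semisimple ring $S_0$, then the diagram $$\begin{array}{ccc} S_0^* & \xrightarrow{\ \det_0\ } & E_0^*/[E_0^*,E_0^*]\\ \downarrow & & \downarrow\\ S_h^* & \xrightarrow{\ \det_E\ } & E_h^*/[E_h^*,E_h^*]\end{array}$$ whose vertical maps are induced by inclusions is commutative.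
   Context: A graded ring $E=\bigoplus_{\gamma\in\Gamma}E_\gamma$ is a graded division ring if every nonzero homogeneous element is a unit (two-sided inverse); then $\Gamma_E=\{\gamma:E_\gamma\neq0\}$ is a subgroup of $\Gamma$. $E_h^*$ is the group of nonzero homogeneous elements of $E$; $E_0$ is a division ring. $\mathbb M_n(E)(\overline\delta)$ is the matrix ring $\mathbb M_n(E)$ with the shifted grading in which the $\lambda$-component consists of the matrices whose $(i,j)$-entry lies in $E_{\lambda+\delta_j-\delta_i}$ for all $i,j$. $S_h^*=\mathrm{GL}_n^h(E)(\overline\delta)$ is the group of homogeneous units of $S$, and $S_0$ is the degree-$0$ component. Strict Bruhat decomposition: every $A\in S_h^*$ can be written uniquely as $A=TUP_\pi V$ with $T\in S$ unipotent lower triangular (lower triangular with $1$'s on the diagonal), $U\in S$ diagonal and invertible, $P_\pi$ the permutation matrix of $\pi\in S_n$ (with $1$ in the $(\pi(i),i)$-positions), and $V\in S$ unipotent upper triangular with $P_\pi VP_\pi^{-1}$ also unipotent upper triangular. The diagonal entries of $U$ are then nonzero homogeneous elements of $E$. Dieudonné determinant of $S_0$: let $\varepsilon_1+\Gamma_E,\dots,\varepsilon_k+\Gamma_E$ be the distinct cosets among the $\delta_i+\Gamma_E$ in $\Gamma/\Gamma_E$, let $I_\ell=\{i:\delta_i+\Gamma_E=\varepsilon_\ell+\Gamma_E\}$ and $r_\ell=|I_\ell|$. Choosing $w_i\in E_h^*$ with $\deg w_i=\varepsilon_\ell-\delta_i$ for $i\in I_\ell$, one has an isomorphism $S_0\cong\mathbb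 M_{r_1}(E_0)\times\dots\times\mathbb M_{r_k}(E_0)$ sending $A=(a_{ij})$ to $(A_1,\dots,A_k)$ with $A_\ell=(w_i^{-1}a_{ij}w_j)_{i,j\in I_\ell}$. Then $\det_0(A)=\prod_{\ell=1}^k\det_\ell(A_\ell)$, where $\det_\ell\colon\mathrm{GL}_{r_\ell}(E_0)\to E_0^*/[E_0^*,E_0^*]$ is the usual Dieudonné determinant over the division ring $E_0$. (When the $\delta_i$ are $\varepsilon_1,\dots,\varepsilon_1,\dots,\varepsilon_k,\dots,\varepsilon_k$ one may take all $w_i=1$, and $A$ is literally block diagonal with blocks $A_\ell$.) *)

theory Defs
  imports
    "HOL-Algebra.Generated_Groups"
    "HOL-Combinatorics.Permutations"
    "Jordan_Normal_Form.Matrix"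
    "Jordan_Normal_Form.DL_Submatrix"
begin

section \<open>Graded division rings\<close>

text \<open>
  The grading group \<open>\<Gamma>\<close> is the type \<open>'g\<close>, the underlying ring is the type \<open>'e\<close>, and \<open>E \<gamma>\<close> is the
  homogeneous component of degree \<open>\<gamma>\<close>. The last assumption says that \<open>'e\<close> is the direct sum of
  the components; \<open>f\<close> is the family of homogeneous components of \<open>x\<close>.
\<close>

locale graded_ring =
  fixes E :: "'g::ab_group_add \<Rightarrow> 'e::ring_1 set"
  assumes zero_component: "0 \<in> E \<gamma>"
    and add_component: "x \<in> E \<gamma> \<Longrightarrow> y \<in> E \<gamma> \<Longrightarrow> x + y \<in> E \<gamma>"
    and uminus_component: "x \<in> E \<gamma> \<Longrightarrow> - x \<in> E \<gamma>"
    and mult_component: "x \<in> E \<gamma> \<Longrightarrow> y \<in> E \<eta> \<Longrightarrow> x * y \<in> E (\<gamma> + \<eta>)"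
    and direct_sum: "\<exists>!f. finite {\<gamma>. f \<gamma> \<noteq> 0} \<and> (\<forall>\<gamma>. f \<gamma> \<in> E \<gamma>) \<and> x = (\<Sum>\<gamma> | f \<gamma> \<noteq> 0. f \<gamma>)"

locale graded_division_ring = graded_ring +
  assumes homogeneous_unit: "x \<in> E \<gamma> \<Longrightarrow> x \<noteq> 0 \<Longrightarrow> \<exists>y. x * y = 1 \<and> y * x = 1"

definition grade_support :: "('g \<Rightarrow> 'e::zero set) \<Rightarrow> 'g set" where
  "grade_support E = {\<gamma>. E \<gamma> \<noteq> {0}}"

text \<open>
  For \<open>K = E 0\<close>, and for \<open>K\<close> the set of all homogeneous elements of a graded division ring, this
  is a group, namely \<open>E\<^sub>0\<^sup>*\<close> and \<open>E\<^sub>h\<^sup>*\<close> respectively.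
\<close>

definition nonzero_monoid :: "'e::ring_1 set \<Rightarrow> 'e monoid" where
  "nonzero_monoid K = \<lparr>carrier = K - {0}, monoid.mult = (*), one = 1\<rparr>"

definition homog_units :: "('g \<Rightarrow> 'e::ring_1 set) \<Rightarrow> 'e monoid" where
  "homog_units E = nonzero_monoid (\<Union>\<gamma>. E \<gamma>)"

definition abelianization :: "('a, 'b) monoid_scheme \<Rightarrow> 'a set monoid" where
  "abelianization G = G Mod (derived G (carrier G))"

definition ab_class :: "('a, 'b) monoid_scheme \<Rightarrow> 'a \<Rightarrow> 'a set" where
  "ab_class G x = derived G (carrier G) #>\<^bsub>G\<^esub> x"

text \<open>
  The map on abelianizations induced by \<open>h\<close> from the source to \<open>G\<close>: for a coset \<open>c\<close> all \<open>h x\<close>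
  with \<open>x \<in> c\<close> have the same class, and the image of \<open>c\<close> is that class.
\<close>

definition ab_map :: "('b, 'c) monoid_scheme \<Rightarrow> ('a \<Rightarrow> 'b) \<Rightarrow> 'a set \<Rightarrow> 'b set" where
  "ab_map G h c = the_elem ((\<lambda>x. ab_class G (h x)) ` c)"


section \<open>Matrices with shifted grading\<close>

text \<open>The ring of \<open>n \<times> n\<close> matrices over a subring \<open>K\<close> of the (noncommutative) ring \<open>'e\<close>.\<close>

definition mat_ring_over :: "'e::ring_1 set \<Rightarrow> nat \<Rightarrow> 'e mat ring" where
  "mat_ring_over K n =
     (ring_mat TYPE('e) n ()) \<lparr>carrier := {A \<in> carrier_mat n n. elements_mat A \<subseteq> K}\<rparr>"

text \<open>Here and below rows, columns and shifts are indexed by \<open>0, \<dots>, n - 1\<close>.\<close>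

definition shifted_component ::
    "('g::ab_group_add \<Rightarrow> 'e set) \<Rightarrow> nat \<Rightarrow> (nat \<Rightarrow> 'g) \<Rightarrow> 'g \<Rightarrow> 'e mat set" where
  "shifted_component E n \<delta> \<gamma> =
     {A \<in> carrier_mat n n. \<forall>i<n. \<forall>j<n. A $$ (i,j) \<in> E (\<gamma> + \<delta> j - \<delta> i)}"

definition homog_GL ::
    "('g::ab_group_add \<Rightarrow> 'e::ring_1 set) \<Rightarrow> nat \<Rightarrow> (nat \<Rightarrow> 'g) \<Rightarrow> 'e mat monoid" where
  "homog_GL E n \<delta> =
     (units_of (mat_ring_over UNIV n))
       \<lparr>carrier := Units (mat_ring_over UNIV n) \<inter> (\<Union>\<gamma>. shifted_component E n \<delta> \<gamma>)\<rparr>"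

definition degree_zero_ring ::
    "('g::ab_group_add \<Rightarrow> 'e::ring_1 set) \<Rightarrow> nat \<Rightarrow> (nat \<Rightarrow> 'g) \<Rightarrow> 'e mat ring" where
  "degree_zero_ring E n \<delta> = (mat_ring_over UNIV n) \<lparr>carrier := shifted_component E n \<delta> 0\<rparr>"


section \<open>Strict Bruhat decomposition\<close>

definition unipotent_upper :: "'e::{zero,one} mat \<Rightarrow> bool" where
  "unipotent_upper A \<longleftrightarrow> upper_triangular A \<and> (\<forall>i<dim_row A. A $$ (i,i) = 1)"

definition unipotent_lower :: "'e::{zero,one} mat \<Rightarrow> bool" where
  "unipotent_lower A \<longleftrightarrow>
     (\<forall>i<dim_row A. \<forall>j<dim_col A. i < j \<longrightarrow> A $$ (i,j) = 0) \<and> (\<forall>i<dim_row A. A $$ (i,i) = 1)"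

definition perm_matrix :: "nat \<Rightarrow> (nat \<Rightarrow> nat) \<Rightarrow> 'e::{zero,one} mat" where
  "perm_matrix n \<pi> = mat n n (\<lambda>(i,j). if i = \<pi> j then 1 else 0)"

definition strict_bruhat ::
    "'e::ring_1 set \<Rightarrow> nat \<Rightarrow> 'e mat \<Rightarrow> 'e mat \<Rightarrow> 'e mat \<Rightarrow> (nat \<Rightarrow> nat) \<Rightarrow> 'e mat \<Rightarrow> bool" where
  "strict_bruhat K n A T U \<pi> V \<longleftrightarrow>
     T \<in> carrier (mat_ring_over K n) \<and> unipotent_lower T \<and>
     U \<in> Units (mat_ring_over K n) \<and> diagonal_mat U \<and>
     \<pi> permutes {..<n} \<and>
     V \<in> carrier (mat_ring_over K n) \<and> unipotent_upper V \<and>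
     unipotent_upper (perm_matrix n \<pi> * V * inv\<^bsub>mat_ring_over K n\<^esub> (perm_matrix n \<pi>)) \<and>
     A = T * U * perm_matrix n \<pi> * V"

text \<open>The element \<open>sgn(\<pi>) u\<^sub>1 \<cdots> u\<^sub>n\<close>, with the factors multiplied in this order.\<close>

definition bruhat_value :: "'e::ring_1 mat \<Rightarrow> (nat \<Rightarrow> nat) \<Rightarrow> 'e" where
  "bruhat_value U \<pi> = of_int (sign \<pi>) * prod_list (diag_mat U)"


section \<open>The Dieudonne determinant in degree zero\<close>

text \<open>
  The usual Dieudonne determinant of \<open>A \<in> GL\<^sub>r(K)\<close>, for \<open>K\<close> a division ring (embedded in \<open>'e\<close> as a
  subring). As in Draxl's \<open>Skew Fields\<close>, it is read off from the strict Bruhat decomposition of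
  \<open>A\<close> over \<open>K\<close>, which exists and is unique.
\<close>

definition dieudonne_det :: "'e::ring_1 set \<Rightarrow> 'e mat \<Rightarrow> 'e set" where
  "dieudonne_det K A =
     (THE c. \<exists>T U \<pi> V. strict_bruhat K (dim_row A) A T U \<pi> V \<and>
                       c = ab_class (nonzero_monoid K) (bruhat_value U \<pi>))"

definition grade_coset :: "('g::ab_group_add \<Rightarrow> 'e::zero set) \<Rightarrow> 'g \<Rightarrow> 'g set" where
  "grade_coset E \<gamma> = (\<lambda>\<eta>. \<gamma> + \<eta>) ` grade_support E"

definition index_block ::
    "('g::ab_group_add \<Rightarrow> 'e::zero set) \<Rightarrow> nat \<Rightarrow> (nat \<Rightarrow> 'g) \<Rightarrow> 'g \<Rightarrow> nat set" where
  "index_block E n \<delta> \<epsilon>\<^sub>l = {i. i < n \<and> grade_coset E (\<delta> i) = grade_coset E \<epsilon>\<^sub>l}"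

text \<open>
  The auxiliary choices: representatives \<open>\<epsilon> 0, \<dots>, \<epsilon> (k - 1)\<close> of the distinct cosets among the
  \<open>\<delta> i + \<Gamma>\<^sub>E\<close>, and homogeneous units \<open>w i\<close> of degree \<open>\<epsilon> l - \<delta> i\<close> for \<open>i\<close> in the \<open>l\<close>-th block.
\<close>

definition block_choice ::
    "('g::ab_group_add \<Rightarrow> 'e::zero set) \<Rightarrow> nat \<Rightarrow> (nat \<Rightarrow> 'g) \<Rightarrow> nat \<Rightarrow> (nat \<Rightarrow> 'g) \<Rightarrow> (nat \<Rightarrow> 'e) \<Rightarrow> bool"
  where
  "block_choice E n \<delta> k \<epsilon> w \<longleftrightarrow>
     inj_on (\<lambda>l. grade_coset E (\<epsilon> l)) {..<k} \<and>
     (\<lambda>l. grade_coset E (\<epsilon> l)) ` {..<k} = (\<lambda>i. grade_coset E (\<delta> i)) ` {..<n} \<and>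
     (\<forall>l<k. \<forall>i\<in>index_block E n \<delta> (\<epsilon> l). w i \<in> E (\<epsilon> l - \<delta> i) \<and> w i \<noteq> 0)"

definition block_matrix ::
    "('g::ab_group_add \<Rightarrow> 'e::ring_1 set) \<Rightarrow> nat \<Rightarrow> (nat \<Rightarrow> 'g) \<Rightarrow> (nat \<Rightarrow> 'e) \<Rightarrow> 'e mat \<Rightarrow> 'g \<Rightarrow> 'e mat"
  where
  "block_matrix E n \<delta> w A \<epsilon>\<^sub>l =
     submatrix (mat n n (\<lambda>(i,j). inv\<^bsub>homog_units E\<^esub> (w i) * A $$ (i,j) * w j))
       (index_block E n \<delta> \<epsilon>\<^sub>l) (index_block E n \<delta> \<epsilon>\<^sub>l)"

definition det_zero ::
    "('g::ab_group_add \<Rightarrow> 'e::ring_1 set) \<Rightarrow> nat \<Rightarrow> (nat \<Rightarrow> 'g) \<Rightarrow> nat \<Rightarrow> (nat \<Rightarrow> 'g) \<Rightarrow> (nat \<Rightarrow> 'e)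
      \<Rightarrow> 'e mat \<Rightarrow> 'e set" where
  "det_zero E n \<delta> k \<epsilon> w A =
     finprod (abelianization (nonzero_monoid (E 0)))
       (\<lambda>l. dieudonne_det (E 0) (block_matrix E n \<delta> w A (\<epsilon> l))) {..<k}"

end

theory Submission
  imports Defs
begin

text \<open>
  Gaussian elimination writes every homogeneous invertible matrix as \<open>T U P\<^sub>\<pi> V\<close>, and \<open>\<pi>\<close> and \<open>U\<close> are
  unique, so the formula for the determinant is a definition and only multiplicativity has to be
  proved. Left multiplication by a lower unipotent or a diagonal matrix clearly has the right
  effect. If row permutations change the value by their sign, then the same holds for upper
  unipotent matrices, which are conjugate to lower ones by the order-reversing permutation, and
  multiplicativity follows from the decomposition of the left factor. So everything reduces to the
  exchange of two adjacent rows, which is a computation with \<open>2 \<times> 2\<close> blocks.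

  A permutation of the rows does not preserve the shifts \<open>\<delta>\<close>. Therefore rows and columns get
  independent shifts \<open>\<alpha>\<close> and \<open>\<beta>\<close>, and the matrices form a groupoid.

  For the diagram, conjugation by \<open>diag(w)\<close> turns a matrix in \<open>S\<^sub>0\<close> into an interleaved block diagonal
  matrix over \<open>E\<^sub>0\<close>, which is a product of its blocks extended by the identity.
\<close>


section \<open>Homogeneous units\<close>

text \<open>The decompositions inside the proof (\<open>bruhat\<close>) ask of \<open>V\<close> only
  that it be upper unipotent. Row operations can destroy strictness but preserve this weaker form,
  which still determines \<pi> and \<open>U\<close>. Strictness is recovered from the elimination in
  one place, for the blocks over \<open>E 0\<close>, because \<open>dieudonne_det\<close> reads
  strict decompositions. Uniqueness never looks at degrees. Hence the value of a matrix does not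
  depend on the shifts attached to it, and the same matrix may be compared under two different pairs
  of shifts. The sign of an adjacent row exchange has two sources. Either the permutation changes
  and the pivots are merely permuted, or the permutation stays and two pivots are multiplied by
  \<open>a\<close> and by \<open>-1/a\<close>. Only modulo commutators do both cases give the same
  factor.\<close>

lemma (in group) comm_group_abelianization: "comm_group (abelianization G)"
  unfolding abelianization_def by (rule derived_quot_is_comm_group)

lemma (in group) ab_class_hom: "ab_class G \<in> hom G (abelianization G)"
proof -
  interpret normal "derived G (carrier G)" G
    by (rule derived_self_is_normal)
  show ?thesis
    using r_coset_hom_Mod by (simp add: ab_class_def [abs_def] abelianization_def)
qed

section \<open>Homogeneous components in a graded ring\<close>

context graded_ring
begin

lemma diff_component: "x \<in> E \<gamma> \<Longrightarrow> y \<in> E \<gamma> \<Longrightarrow> x - y \<in> E \<gamma>"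
  using add_component[of x \<gamma> "- y"] uminus_component[of y \<gamma>] by simp

lemma sum_component: "(\<And>i. i \<in> I \<Longrightarrow> f i \<in> E \<gamma>) \<Longrightarrow> sum f I \<in> E \<gamma>"
  by (induction I rule: infinite_finite_induct) (auto intro: zero_component add_component)

lemma mult_component': "x \<in> E \<gamma> \<Longrightarrow> y \<in> E \<eta> \<Longrightarrow> \<gamma> + \<eta> = \<zeta> \<Longrightarrow> x * y \<in> E \<zeta>"
  using mult_component by blast

text \<open>\<open>direct_sum\<close> sums each family over its own support; a common finite index
  set \<open>F\<close> makes two families comparable.\<close>

lemma homogeneous_sum_unique:
  assumes "finite F" "\<And>\<gamma>. f \<gamma> \<in> E \<gamma>" "\<And>\<gamma>. g \<gamma> \<in> E \<gamma>"
    and "\<And>\<gamma>. \<gamma> \<notin> F \<Longrightarrow> f \<gamma> = 0" "\<And>\<gamma>. \<gamma> \<notin> F \<Longrightarrow> g \<gamma> = 0"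
    and "sum f F = sum g F"
  shows "f = g"
proof -
  have supp: "{\<gamma>. h \<gamma> \<noteq> 0} \<subseteq> F" if "\<And>\<gamma>. \<gamma> \<notin> F \<Longrightarrow> h \<gamma> = 0" for h :: "'g \<Rightarrow> 'e"
    using that by blast
  have eq: "sum h F = (\<Sum>\<gamma> | h \<gamma> \<noteq> 0. h \<gamma>)" if "\<And>\<gamma>. \<gamma> \<notin> F \<Longrightarrow> h \<gamma> = 0" for h
    by (rule sum.mono_neutral_right) (use assms(1) that in auto)
  have "finite {\<gamma>. f \<gamma> \<noteq> 0}" "finite {\<gamma>. g \<gamma> \<noteq> 0}"
    using supp[of f] supp[of g] assms by (auto intro: finite_subset)
  moreover have "sum f F = (\<Sum>\<gamma> | f \<gamma> \<noteq> 0. f \<gamma>)" "sum f F = (\<Sum>\<gamma> | g \<gamma> \<noteq> 0. g \<gamma>)"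
    using eq[of f] eq[of g] assms by auto
  ultimately show ?thesis
    using direct_sum[of "sum f F"] assms(2,3) by blast
qed

lemma homogeneous_decomposition:
  "\<exists>f F. finite F \<and> (\<forall>\<gamma>. f \<gamma> \<in> E \<gamma>) \<and> (\<forall>\<gamma>. \<gamma> \<notin> F \<longrightarrow> f \<gamma> = 0) \<and> x = sum f F"
proof -
  obtain f where "finite {\<gamma>. f \<gamma> \<noteq> 0}" "\<forall>\<gamma>. f \<gamma> \<in> E \<gamma>" "x = (\<Sum>\<gamma> | f \<gamma> \<noteq> 0. f \<gamma>)"
    using direct_sum[of x] by blast
  then show ?thesis by (intro exI[of _ f] exI[of _ "{\<gamma>. f \<gamma> \<noteq> 0}"]) auto
qed

text \<open>Left multiplication by \<open>x\<close> shifts the components of \<open>y\<close> by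
  \<gamma>. Since \<open>x * y\<close> is concentrated in degree \<zeta>, only the component of
  \<open>y\<close> in degree \<zeta> - \<gamma> can contribute.\<close>

lemma homogeneous_product_component:
  assumes "x \<in> E \<gamma>" "x * y \<in> E \<zeta>" "finite F" "\<And>\<eta>. f \<eta> \<in> E \<eta>" "\<And>\<eta>. \<eta> \<notin> F \<Longrightarrow> f \<eta> = 0"
    and y: "y = sum f F"
  shows "x * f (\<zeta> - \<gamma>) = x * y"
proof -
  define g where "g = (\<lambda>\<eta>. x * f (\<eta> - \<gamma>))"
  define h where "h = (\<lambda>\<eta>. if \<eta> = \<zeta> then x * y else 0)"
  define F' where "F' = insert \<zeta> ((\<lambda>\<eta>. \<eta> + \<gamma>) ` F)"
  have "g = h"
  proof (rule homogeneous_sum_unique[of F'])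
    show "finite F'" using assms by (simp add: F'_def)
    show "g \<eta> \<in> E \<eta>" for \<eta>
      unfolding g_def by (rule mult_component'[of _ \<gamma> _ "\<eta> - \<gamma>"]) (use assms in auto)
    show "h \<eta> \<in> E \<eta>" for \<eta>
      using assms zero_component by (auto simp: h_def)
    show g0: "g \<eta> = 0" if "\<eta> \<notin> F'" for \<eta>
    proof -
      have "\<eta> - \<gamma> \<notin> F" using that by (force simp: F'_def image_iff)
      then show ?thesis using assms(5) by (simp add: g_def)
    qed
    show "h \<eta> = 0" if "\<eta> \<notin> F'" for \<eta>
      using that by (auto simp: F'_def h_def)
    have "sum g F' = sum g ((\<lambda>\<eta>. \<eta> + \<gamma>) ` F)"
    proof (rule sum.mono_neutral_right)
      show "\<forall>i\<in>F' - (\<lambda>\<eta>. \<eta> + \<gamma>) ` F. g i = 0"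
      proof
        fix i assume "i \<in> F' - (\<lambda>\<eta>. \<eta> + \<gamma>) ` F"
        then have "i - \<gamma> \<notin> F" by (force simp: image_iff)
        then show "g i = 0" using assms(5) by (simp add: g_def)
      qed
    qed (use assms in \<open>auto simp: F'_def\<close>)
    also have "\<dots> = (\<Sum>\<eta>\<in>F. g (\<eta> + \<gamma>))"
      by (subst sum.reindex) (auto simp: inj_on_def)
    also have "\<dots> = x * y" by (simp add: g_def y sum_distrib_left)
    also have "\<dots> = sum h F'"
      using assms(3) by (simp add: h_def F'_def)
    finally show "sum g F' = sum h F'" .
  qed
  then have "g \<zeta> = h \<zeta>" by simp
  then show ?thesis by (simp add: g_def h_def)
qed

text \<open>The degree 0 component of 1 is a right identity for each component of 1, hence for their
  sum 1, and so it equals 1.\<close>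

lemma one_component: "1 \<in> E 0"
proof -
  obtain f F where f: "finite F" "\<And>\<gamma>. f \<gamma> \<in> E \<gamma>" "\<And>\<gamma>. \<gamma> \<notin> F \<Longrightarrow> f \<gamma> = 0" "1 = sum f F"
    using homogeneous_decomposition[of 1] by blast
  have "f \<gamma> * f 0 = f \<gamma>" for \<gamma>
    using homogeneous_product_component[of "f \<gamma>" \<gamma> 1 \<gamma>, OF _ _ f(1) f(2) f(3)] f by simp
  then have "sum f F * f 0 = sum f F" by (simp add: sum_distrib_right)
  then have "f 0 = 1" using f(4) by simp
  then show ?thesis using f(2)[of 0] by simp
qed

end

section \<open>The group of nonzero homogeneous elements\<close>

context graded_division_ring
begin

abbreviation "Eh \<equiv> homog_units E"
abbreviation "Ab \<equiv> abelianization (homog_units E)"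
abbreviation "cls \<equiv> ab_class (homog_units E)"

text \<open>The inverse supplied by \<open>homogeneous_unit\<close> may a priori be inhomogeneous.
  Its component of degree -\<gamma> is already a right inverse of \<open>x\<close>, so it is the
  whole inverse.\<close>

lemma homogeneous_inverse:
  assumes "x \<in> E \<gamma>" "x \<noteq> 0"
  obtains y where "y \<in> E (- \<gamma>)" "x * y = 1" "y * x = 1"
proof -
  obtain y where y: "x * y = 1" "y * x = 1" using homogeneous_unit assms by blast
  obtain f F where f: "finite F" "\<And>\<gamma>. f \<gamma> \<in> E \<gamma>" "\<And>\<gamma>. \<gamma> \<notin> F \<Longrightarrow> f \<gamma> = 0" "y = sum f F"
    using homogeneous_decomposition[of y] by blast
  have "x * f (0 - \<gamma>) = 1"
    using homogeneous_product_component[OF assms(1) _ f(1,2,3), of y 0] f(4) y one_component by simp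
  then have "y * (x * f (- \<gamma>)) = y" by simp
  then have "f (- \<gamma>) = y" using y by (simp flip: mult.assoc)
  then show ?thesis using that[of y] f(2)[of "- \<gamma>"] y by simp
qed

lemma Eh_simps [simp]:
  "monoid.mult Eh = (*)" "one Eh = 1"
  by (auto simp: homog_units_def nonzero_monoid_def)

lemma Eh_carrier_iff: "x \<in> carrier Eh \<longleftrightarrow> x \<noteq> 0 \<and> (\<exists>\<gamma>. x \<in> E \<gamma>)"
  by (auto simp: homog_units_def nonzero_monoid_def)

lemma mult_homogeneous_nonzero:
  assumes "x \<in> E \<gamma>" "x \<noteq> 0" "y \<noteq> 0"
  shows "x * y \<noteq> 0"
proof
  assume "x * y = 0"
  obtain z where "z * x = 1" using homogeneous_inverse[OF assms(1,2)] by metis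
  then have "z * (x * y) = y" by (simp flip: mult.assoc)
  then show False using \<open>x * y = 0\<close> assms by simp
qed

lemma group_Eh: "group Eh"
proof (rule groupI)
  fix x assume x: "x \<in> carrier Eh"
  then obtain \<gamma> where "x \<in> E \<gamma>" "x \<noteq> 0" by (auto simp: Eh_carrier_iff)
  then obtain y where y: "y \<in> E (- \<gamma>)" "x * y = 1" "y * x = 1"
    using homogeneous_inverse by metis
  then show "\<exists>y\<in>carrier Eh. y \<otimes>\<^bsub>Eh\<^esub> x = \<one>\<^bsub>Eh\<^esub>"
    by (intro bexI[of _ y]) (auto simp: Eh_carrier_iff)
next
  show "x \<otimes>\<^bsub>Eh\<^esub> y \<in> carrier Eh" if "x \<in> carrier Eh" "y \<in> carrier Eh" for x y
    using that mult_homogeneous_nonzero mult_component by (fastforce simp: Eh_carrier_iff)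
qed (use one_component in \<open>auto simp: mult.assoc Eh_carrier_iff\<close>)

sublocale Eh: group Eh
  by (rule group_Eh)

lemma homogeneous_in_Eh: "x \<in> E \<gamma> \<Longrightarrow> x \<noteq> 0 \<Longrightarrow> x \<in> carrier Eh"
  by (auto simp: Eh_carrier_iff)

lemma hinv [simp]:
  assumes "x \<in> carrier Eh"
  shows "x * inv\<^bsub>Eh\<^esub> x = 1" "inv\<^bsub>Eh\<^esub> x * x = 1" "inv\<^bsub>Eh\<^esub> x \<noteq> 0"
  using Eh.r_inv[OF assms] Eh.l_inv[OF assms] Eh.inv_closed[OF assms] by (auto simp: Eh_carrier_iff)

lemma hinv_cancel [simp]:
  assumes "x \<in> carrier Eh"
  shows "x * (inv\<^bsub>Eh\<^esub> x * y) = y" "inv\<^bsub>Eh\<^esub> x * (x * y) = y"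
  using hinv[OF assms] by (simp_all flip: mult.assoc)

lemma hinv_component:
  assumes "x \<in> E \<gamma>" "x \<noteq> 0"
  shows "inv\<^bsub>Eh\<^esub> x \<in> E (- \<gamma>)"
proof -
  obtain y where y: "y \<in> E (- \<gamma>)" "x * y = 1" "y * x = 1"
    using homogeneous_inverse[OF assms] by metis
  have "x \<in> carrier Eh" using assms by (auto simp: Eh_carrier_iff)
  then have "inv\<^bsub>Eh\<^esub> x * (x * y) = y" by simp
  then have "inv\<^bsub>Eh\<^esub> x = y" using y by simp
  then show ?thesis using y by simp
qed

sublocale Ab: comm_group Ab
  by (rule Eh.comm_group_abelianization)

lemmas cls_hom = Eh.ab_class_hom

lemma cls_closed [simp]: "x \<in> carrier Eh \<Longrightarrow> cls x \<in> carrier Ab"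
  using cls_hom by (rule hom_in_carrier)

lemma cls_mult: "x \<in> carrier Eh \<Longrightarrow> y \<in> carrier Eh \<Longrightarrow> cls (x * y) = cls x \<otimes>\<^bsub>Ab\<^esub> cls y"
  using hom_mult[OF cls_hom, of x y] by simp

lemma cls_one [simp]: "cls 1 = \<one>\<^bsub>Ab\<^esub>"
  using hom_one[OF cls_hom Eh.is_group Ab.is_group] by simp

lemma sign_in_Eh [simp]: "of_int (sign p) \<in> carrier Eh"
  using one_component uminus_component[OF one_component] by (cases p rule: sign_cases) (auto simp: Eh_carrier_iff)

lemma minus_one_in_Eh [simp]: "- 1 \<in> carrier Eh"
  using uminus_component[OF one_component] by (auto simp: Eh_carrier_iff)

lemma cls_minus: "x \<in> carrier Eh \<Longrightarrow> cls (- x) = cls (- 1) \<otimes>\<^bsub>Ab\<^esub> cls x"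
  using cls_mult[of "- 1" x] by simp

end


section \<open>Unipotent matrices and uniqueness of the decomposition\<close>

text \<open>Matrices are plain functions here, meaningful only at indices below \<open>n\<close>:
  rows are permuted by composition and no dimensions have to be carried along.\<close>

definition fmul :: "nat \<Rightarrow> (nat \<Rightarrow> nat \<Rightarrow> 'e::ring_1) \<Rightarrow> (nat \<Rightarrow> nat \<Rightarrow> 'e) \<Rightarrow> nat \<Rightarrow> nat \<Rightarrow> 'e" where
  "fmul n A B = (\<lambda>x y. \<Sum>k<n. A x k * B k y)"

definition unilow :: "nat \<Rightarrow> (nat \<Rightarrow> nat \<Rightarrow> 'e::ring_1) \<Rightarrow> bool" where
  "unilow n T \<longleftrightarrow> (\<forall>i<n. T i i = 1) \<and> (\<forall>x<n. \<forall>y<n. x < y \<longrightarrow> T x y = 0)"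

definition uniup :: "nat \<Rightarrow> (nat \<Rightarrow> nat \<Rightarrow> 'e::ring_1) \<Rightarrow> bool" where
  "uniup n V \<longleftrightarrow> (\<forall>i<n. V i i = 1) \<and> (\<forall>x<n. \<forall>y<n. y < x \<longrightarrow> V x y = 0)"

text \<open>Here \<open>p\<close> is the inverse of the permutation \<open>\<pi>\<close> of the decomposition \<open>T U P\<^sub>\<pi> V\<close>: row \<open>i\<close> of
  \<open>P\<^sub>\<pi> V\<close> is row \<open>p i\<close> of \<open>V\<close>.\<close>

definition bruhat :: "nat \<Rightarrow> (nat \<Rightarrow> nat \<Rightarrow> 'e::ring_1) \<Rightarrow> (nat \<Rightarrow> nat \<Rightarrow> 'e) \<Rightarrow> (nat \<Rightarrow> 'e) \<Rightarrow>
    (nat \<Rightarrow> nat) \<Rightarrow> (nat \<Rightarrow> nat \<Rightarrow> 'e) \<Rightarrow> bool" where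
  "bruhat n A T u p V \<longleftrightarrow> unilow n T \<and> uniup n V \<and> p permutes {..<n} \<and> (\<forall>i<n. u i \<noteq> 0) \<and>
     (\<forall>x<n. \<forall>y<n. A x y = (\<Sum>i<n. T x i * u i * V (p i) y))"

lemma fmul_assoc: "fmul n (fmul n A B) C = fmul n A (fmul n B C)"
proof (intro ext)
  fix x y
  have "fmul n (fmul n A B) C x y = (\<Sum>k<n. \<Sum>j<n. A x j * B j k * C k y)"
    by (simp add: fmul_def sum_distrib_right)
  also have "\<dots> = (\<Sum>j<n. \<Sum>k<n. A x j * B j k * C k y)"
    by (rule sum.swap)
  also have "\<dots> = fmul n A (fmul n B C) x y"
    by (simp add: fmul_def sum_distrib_left mult.assoc)
  finally show "fmul n (fmul n A B) C x y = fmul n A (fmul n B C) x y" .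
qed

lemma fmul_cong:
  "(\<And>k. k < n \<Longrightarrow> A x k = A' x k) \<Longrightarrow> (\<And>k. k < n \<Longrightarrow> B k y = B' k y) \<Longrightarrow>
    fmul n A B x y = fmul n A' B' x y"
  by (simp add: fmul_def)

lemma sum_delta_left: "x < (n::nat) \<Longrightarrow> (\<Sum>k<n. (if x = k then 1 else 0) * f k) = (f x :: 'e::ring_1)"
  by (subst sum.remove[of _ x]) (auto intro: sum.neutral)

lemma sum_delta_right: "x < (n::nat) \<Longrightarrow> (\<Sum>k<n. f k * (if k = x then 1 else 0)) = (f x :: 'e::ring_1)"
  by (subst sum.remove[of _ x]) (auto intro: sum.neutral)

lemma sum_remove_adjacent:
  assumes "Suc m < n"
  shows "(\<Sum>i<n. f i) = f m + f (Suc m) + (\<Sum>i\<in>{..<n} - {m, Suc m}. (f i :: 'e::comm_monoid_add))"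
proof -
  have "{..<n} = insert m (insert (Suc m) ({..<n} - {m, Suc m}))" using assms by auto
  then have "(\<Sum>i<n. f i) = sum f (insert m (insert (Suc m) ({..<n} - {m, Suc m})))" by simp
  also have "\<dots> = f m + f (Suc m) + (\<Sum>i\<in>{..<n} - {m, Suc m}. f i)"
    by (subst sum.insert, simp, simp, subst sum.insert) (simp_all add: add.assoc)
  finally show ?thesis .
qed

lemma unilow_fmul:
  assumes "unilow n S" "unilow n T"
  shows "unilow n (fmul n S T)"
proof -
  have "fmul n S T x y = 0" if "x < y" "y < n" for x y
    unfolding fmul_def
  proof (rule sum.neutral, rule ballI)
    fix k assume "k \<in> {..<n}"
    then show "S x k * T k y = 0"
      using assms that by (cases "x < k") (auto simp: unilow_def)
  qed
  moreover have "fmul n S T x x = 1" if "x < n" for x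
  proof -
    have "S x k * T k x = (if x = k then 1 else 0) * T k k" if "k < n" for k
      using assms that \<open>x < n\<close> by (cases x k rule: linorder_cases) (auto simp: unilow_def)
    then have "fmul n S T x x = (\<Sum>k<n. (if x = k then 1 else 0) * T k k)"
      unfolding fmul_def by (intro sum.cong) auto
    then show ?thesis using assms that by (simp add: sum_delta_left unilow_def)
  qed
  ultimately show ?thesis by (auto simp: unilow_def)
qed

section \<open>Inverses of unipotent matrices\<close>

fun lower_inverse :: "(nat \<Rightarrow> nat \<Rightarrow> 'e::ring_1) \<Rightarrow> nat \<Rightarrow> nat \<Rightarrow> 'e" where
  "lower_inverse T x y = (if x = y then 1 else 0) - (\<Sum>k<x. T x k * lower_inverse T k y)"

declare lower_inverse.simps [simp del]

lemma lower_inverse_eq_0: "x < y \<Longrightarrow> lower_inverse T x y = 0"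
proof (induction x rule: less_induct)
  case (less x)
  then show ?case by (subst lower_inverse.simps) simp
qed

lemma unilow_lower_inverse: "unilow n (lower_inverse T)"
  unfolding unilow_def
  by (auto simp: lower_inverse_eq_0 lower_inverse.simps[of T i i for i] intro!: sum.neutral)

lemma fmul_lower_inverse:
  assumes "unilow n T" "x < n"
  shows "fmul n T (lower_inverse T) x y = (if x = y then 1 else 0)"
proof -
  have "fmul n T (lower_inverse T) x y = (\<Sum>k\<in>{..x}. T x k * lower_inverse T k y)"
    unfolding fmul_def by (rule sum.mono_neutral_right) (use assms in \<open>auto simp: unilow_def\<close>)
  also have "{..x} = insert x {..<x}" by auto
  also have "(\<Sum>k\<in>insert x {..<x}. T x k * lower_inverse T k y) =
      lower_inverse T x y + (\<Sum>k<x. T x k * lower_inverse T k y)"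
    using assms by (simp add: unilow_def)
  also have "\<dots> = (if x = y then 1 else 0)" by (simp add: lower_inverse.simps[of T x y])
  finally show ?thesis .
qed

text \<open>The construction yields a right inverse. Applied twice it gives \<open>S\<close> and
  \<open>R\<close> with \<open>T S = 1\<close> and \<open>S R = 1\<close>, so
  \<open>T = T S R = R\<close> and therefore \<open>S T = S R = 1\<close>.\<close>

lemma lower_inverse_fmul:
  assumes T: "unilow n T" and xy: "x < n" "y < n"
  shows "fmul n (lower_inverse T) T x y = (if x = y then 1 else 0)"
proof -
  define S where "S = lower_inverse T"
  define R where "R = lower_inverse S"
  have S: "unilow n S" by (simp add: S_def unilow_lower_inverse)
  have "T x y = R x y" if "x < n" "y < n" for x y
  proof -
    have "T x y = (\<Sum>k<n. T x k * (if k = y then 1 else 0))" using that by (simp add: sum_delta_right)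
    also have "\<dots> = fmul n T (fmul n S R) x y"
      unfolding fmul_def[of n T] by (rule sum.cong) (simp_all add: R_def fmul_lower_inverse[OF S])
    also have "\<dots> = fmul n (fmul n T S) R x y" by (simp add: fmul_assoc)
    also have "\<dots> = (\<Sum>k<n. (if x = k then 1 else 0) * R k y)"
      unfolding fmul_def[of n _ R]
      by (rule sum.cong) (simp_all add: S_def fmul_lower_inverse[OF T] that)
    also have "\<dots> = R x y" using that by (simp add: sum_delta_left)
    finally show ?thesis .
  qed
  then have "fmul n S T x y = fmul n S R x y"
    using xy by (intro fmul_cong) auto
  then show ?thesis using fmul_lower_inverse[OF S xy(1), of y] by (simp add: S_def R_def)
qed

text \<open>Reversing the order of the indices commutes with \<open>fmul\<close>, so through this
  equivalence products and inverses of upper unipotent matrices come from the lower case.\<close>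

lemma uniup_iff_unilow_reverse: "uniup n V \<longleftrightarrow> unilow n (\<lambda>x y. V (n - Suc x) (n - Suc y))"
proof
  assume *: "unilow n (\<lambda>x y. V (n - Suc x) (n - Suc y))"
  have "V x y = 0" if "y < x" "x < n" for x y
  proof -
    have "n - Suc x < n - Suc y" "n - Suc x < n" "n - Suc y < n" using that by auto
    then have "V (n - Suc (n - Suc x)) (n - Suc (n - Suc y)) = 0" using * unfolding unilow_def by blast
    then show ?thesis using that by simp
  qed
  moreover have "V x x = 1" if "x < n" for x
  proof -
    have "n - Suc x < n" using that by simp
    then have "V (n - Suc (n - Suc x)) (n - Suc (n - Suc x)) = 1" using * unfolding unilow_def by blast
    then show ?thesis using that by simp
  qed
  ultimately show "uniup n V" by (auto simp: uniup_def)
qed (auto simp: uniup_def unilow_def)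

lemma fmul_reverse:
  "fmul n (\<lambda>x y. A (n - Suc x) (n - Suc y)) (\<lambda>x y. B (n - Suc x) (n - Suc y)) x y
    = fmul n A B (n - Suc x) (n - Suc y)"
  unfolding fmul_def
  by (rule sum.nat_diff_reindex[of "\<lambda>k. A (n - Suc x) k * B k (n - Suc y)"])

lemma uniup_fmul:
  assumes "uniup n S" "uniup n T"
  shows "uniup n (fmul n S T)"
  using assms unilow_fmul unfolding uniup_iff_unilow_reverse fmul_reverse[symmetric] by blast

lemma uniup_right_inverse:
  assumes "uniup n V"
  obtains W where "uniup n W" "\<And>x y. x < n \<Longrightarrow> y < n \<Longrightarrow> fmul n V W x y = (if x = y then 1 else 0)"
proof -
  define T where "T = (\<lambda>x y. V (n - Suc x) (n - Suc y))"
  define S where "S = lower_inverse T"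
  define W where "W = (\<lambda>x y. S (n - Suc x) (n - Suc y))"
  have T: "unilow n T" using assms by (simp add: uniup_iff_unilow_reverse T_def)
  have W': "W (n - Suc x) (n - Suc y) = S x y" if "x < n" "y < n" for x y
    using that by (simp add: W_def)
  then have "uniup n W"
    using unilow_lower_inverse[of n T] unfolding uniup_iff_unilow_reverse
    by (simp add: unilow_def S_def)
  moreover have "fmul n V W x y = (if x = y then 1 else 0)" if "x < n" "y < n" for x y
  proof -
    define x' y' where "x' = n - Suc x" "y' = n - Suc y"
    have lt: "x' < n" "y' < n" "x = n - Suc x'" "y = n - Suc y'" using that by (auto simp: x'_y'_def)
    have "fmul n V W x y = fmul n T (\<lambda>x y. W (n - Suc x) (n - Suc y)) x' y'"
      unfolding T_def fmul_reverse using lt by simp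
    also have "\<dots> = fmul n T S x' y'" using lt W' by (intro fmul_cong) auto
    also have "\<dots> = (if x' = y' then 1 else 0)"
      unfolding S_def using T lt by (intro fmul_lower_inverse)
    finally show ?thesis using that lt by auto
  qed
  ultimately show ?thesis using that by blast
qed

text \<open>Clearing \<open>T'\<close> from the left and \<open>V\<close> from the right turns the equality of two
  decompositions into \<open>L U P = U' P' M\<close> with \<open>L\<close> lower and \<open>M\<close> upper unipotent, where the nonzero
  positions can be compared.\<close>

lemma bruhat_unique:
  assumes B: "bruhat n A T u p V" and B': "bruhat n A T' u' p' V'"
  shows "p = p'" "\<And>i. i < n \<Longrightarrow> u i = u' i"
proof -
  note b = B[unfolded bruhat_def] and b' = B'[unfolded bruhat_def]
  define S where "S = lower_inverse T'"
  obtain W where W: "uniup n W" "\<And>x y. x < n \<Longrightarrow> y < n \<Longrightarrow> fmul n V W x y = (if x = y then 1 else 0)"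
    using uniup_right_inverse b by blast
  define L where "L = fmul n S T"
  define M where "M = fmul n V' W"
  define N where "N = (\<lambda>i k. u i * V (p i) k)"
  define N' where "N' = (\<lambda>i k. u' i * V' (p' i) k)"
  have L: "unilow n L" unfolding L_def S_def using b by (intro unilow_fmul unilow_lower_inverse) auto
  have M: "uniup n M" unfolding M_def using b' W by (intro uniup_fmul) auto
  have pl: "p i < n" "p' i < n" if "i < n" for i
    using b b' that permutes_in_image[of _ "{..<n}" i] by auto
  \<comment> \<open>Entry \<open>(x, p j)\<close> of \<open>S A W\<close>, computed twice: in the
    first decomposition \<open>V W = 1\<close> leaves the single term \<open>i = j\<close>, in the
    second \<open>S T' = 1\<close> leaves the single row \<open>x\<close>.\<close>
  have eq: "L x j * u j = u' x * M (p' x) (p j)" if "x < n" "j < n" for x j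
  proof -
    have "fmul n L (fmul n N W) x (p j) = (\<Sum>i<n. L x i * u i * (if i = j then 1 else 0))"
      unfolding fmul_def[of n L]
    proof (rule sum.cong)
      fix i assume i: "i \<in> {..<n}"
      have "fmul n N W i (p j) = u i * fmul n V W (p i) (p j)"
        by (simp add: N_def fmul_def sum_distrib_left mult.assoc)
      also have "\<dots> = u i * (if p i = p j then 1 else 0)"
        using i that pl by (simp add: W(2))
      also have "(p i = p j) = (i = j)"
        using b by (metis permutes_inj_on inj_onD UNIV_I)
      finally show "L x i * fmul n N W i (p j) = L x i * u i * (if i = j then 1 else 0)"
        by (simp add: mult.assoc)
    qed auto
    then have "fmul n L (fmul n N W) x (p j) = L x j * u j"
      using that by (simp add: sum_delta_right)
    moreover have "fmul n L (fmul n N W) x (p j) = fmul n S (fmul n (fmul n T N) W) x (p j)"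
      by (simp add: L_def fmul_assoc)
    moreover have "\<dots> = fmul n S (fmul n (fmul n T' N') W) x (p j)"
    proof (rule fmul_cong[OF refl])
      fix k assume k: "k < n"
      have "fmul n T N k j = fmul n T' N' k j" if "j < n" for j
        using b b' that k by (simp add: fmul_def N_def N'_def flip: mult.assoc)
      then show "fmul n (fmul n T N) W k (p j) = fmul n (fmul n T' N') W k (p j)"
        by (rule fmul_cong) auto
    qed
    moreover have "\<dots> = fmul n (fmul n S T') (fmul n N' W) x (p j)"
      by (simp add: fmul_assoc)
    moreover have "\<dots> = (\<Sum>k<n. (if x = k then 1 else 0) * fmul n N' W k (p j))"
      unfolding fmul_def[of n "fmul n S T'"]
      by (rule sum.cong) (use that b' in \<open>auto simp: S_def lower_inverse_fmul\<close>)
    moreover have "\<dots> = fmul n N' W x (p j)" using that by (simp add: sum_delta_left)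
    moreover have "\<dots> = u' x * M (p' x) (p j)"
      by (simp add: N'_def M_def fmul_def sum_distrib_left mult.assoc)
    ultimately show ?thesis by metis
  qed
  \<comment> \<open>The diagonal \<open>L j j = 1\<close>. Since \<open>u j\<close> is nonzero, so
    is \<open>M (p' j) (p j)\<close>, which forces \<open>p' j \<le> p j\<close>. A permutation of
    \<open>{..<n}\<close> that never decreases an index is the identity; then the diagonal of
    \<open>M\<close> gives equal pivots.\<close>
  have eq': "u j = u' j * M (p' j) (p j)" if "j < n" for j
    using eq[OF that that] L that by (simp add: unilow_def)
  have le: "p' j \<le> p j" if "j < n" for j
  proof (rule ccontr)
    assume "\<not> p' j \<le> p j"
    then have "M (p' j) (p j) = 0" using M pl that by (auto simp: uniup_def)
    then show False using eq'[OF that] b that by auto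
  qed
  have "p \<circ> Hilbert_Choice.inv p' = id"
  proof (rule permutes_natset_ge)
    show "p \<circ> Hilbert_Choice.inv p' permutes {..<n}" using b b' by (intro permutes_compose permutes_inv) auto
    show "\<forall>i\<in>{..<n}. i \<le> (p \<circ> Hilbert_Choice.inv p') i"
    proof
      fix i assume "i \<in> {..<n}"
      then have "Hilbert_Choice.inv p' i < n" using b' by (metis lessThan_iff permutes_in_image permutes_inv)
      then show "i \<le> (p \<circ> Hilbert_Choice.inv p') i" using le[of "Hilbert_Choice.inv p' i"] permutes_inverses(1)[of p' "{..<n}" i] b' by simp
    qed
  qed
  then have "p \<circ> Hilbert_Choice.inv p' \<circ> p' = p'" by simp
  then show "p = p'" using b' by (metis comp_assoc comp_id permutes_inv_o(2))
  then show "u i = u' i" if "i < n" for i using eq'[OF that] M pl that by (simp add: uniup_def)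
qed


section \<open>Homogeneous Bruhat decompositions\<close>

context graded_division_ring
begin

text \<open>A homogeneous matrix of degree \<open>\<gamma>\<close> for the shift \<open>\<delta>\<close> is the case \<open>\<alpha> = \<delta>\<close>, \<open>\<beta> = \<gamma> + \<delta>\<close>.\<close>

definition graded_mat :: "nat \<Rightarrow> (nat \<Rightarrow> 'a) \<Rightarrow> (nat \<Rightarrow> 'a) \<Rightarrow> (nat \<Rightarrow> nat \<Rightarrow> 'b) \<Rightarrow> bool" where
  "graded_mat n \<alpha> \<beta> A \<longleftrightarrow> (\<forall>x<n. \<forall>y<n. A x y \<in> E (\<beta> y - \<alpha> x))"

text \<open>\<open>T\<close> lives on the row shifts and \<open>V\<close> on the column shifts, so
  the pivots alone carry the passage from \<alpha> to \<beta>.\<close>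

definition graded_bruhat where
  "graded_bruhat n \<alpha> \<beta> A T u p V \<longleftrightarrow> bruhat n A T u p V \<and> graded_mat n \<alpha> \<alpha> T \<and>
     (\<forall>i<n. u i \<in> E (\<beta> (p i) - \<alpha> i)) \<and> graded_mat n \<beta> \<beta> V"

text \<open>\<open>p\<close> is the inverse of \<pi> and has the same sign. In the abelianization
  the order of the pivots is immaterial, so \<open>finprod\<close> replaces the ordered product of
  \<open>bruhat_value\<close>.\<close>

definition bruhat_class :: "nat \<Rightarrow> (nat \<Rightarrow> 'b) \<Rightarrow> (nat \<Rightarrow> nat) \<Rightarrow> 'b set" where
  "bruhat_class n u p = cls (of_int (sign p)) \<otimes>\<^bsub>Ab\<^esub> finprod Ab (\<lambda>i. cls (u i)) {..<n}"

text \<open>A relation and not a function: it asserts at once that a homogeneous decomposition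
  exists for these shifts and what its value is, so the closure lemmas below need no separate
  invertibility hypothesis.\<close>

definition hdet :: "nat \<Rightarrow> (nat \<Rightarrow> 'a) \<Rightarrow> (nat \<Rightarrow> 'a) \<Rightarrow> (nat \<Rightarrow> nat \<Rightarrow> 'b) \<Rightarrow> 'b set \<Rightarrow> bool" where
  "hdet n \<alpha> \<beta> A c \<longleftrightarrow> (\<exists>T u p V. graded_bruhat n \<alpha> \<beta> A T u p V \<and> c = bruhat_class n u p)"

lemma graded_bruhat_in_Eh:
  "graded_bruhat n \<alpha> \<beta> A T u p V \<Longrightarrow> i < n \<Longrightarrow> u i \<in> carrier Eh"
  by (auto simp: graded_bruhat_def bruhat_def Eh_carrier_iff)

lemma hdet_in_Ab: "hdet n \<alpha> \<beta> A c \<Longrightarrow> c \<in> carrier Ab"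
  by (auto simp: hdet_def bruhat_class_def graded_bruhat_in_Eh)

lemma bruhat_class_cong:
  assumes "\<And>i. i < n \<Longrightarrow> u i = u' i" "\<And>i. i < n \<Longrightarrow> u i \<in> carrier Eh"
  shows "bruhat_class n u p = bruhat_class n u' p"
proof -
  have "finprod Ab (\<lambda>i. cls (u i)) {..<n} = finprod Ab (\<lambda>i. cls (u' i)) {..<n}"
    by (rule Ab.finprod_cong') (use assms in auto)
  then show ?thesis by (simp add: bruhat_class_def)
qed

text \<open>Because \<open>bruhat_unique\<close> ignores degrees, the value can be read from any
  decomposition of \<open>A\<close>, even one whose factors are not known to be homogeneous.\<close>

lemma hdet_bruhat:
  assumes "hdet n \<alpha> \<beta> A c" "bruhat n A T u p V"
  shows "c = bruhat_class n u p" "\<And>i. i < n \<Longrightarrow> u i \<in> carrier Eh"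
proof -
  obtain T' u' p' V' where *: "graded_bruhat n \<alpha> \<beta> A T' u' p' V'" "c = bruhat_class n u' p'"
    using assms(1) by (auto simp: hdet_def)
  then have eq: "p' = p" "\<And>i. i < n \<Longrightarrow> u' i = u i"
    using bruhat_unique assms(2) by (auto simp: graded_bruhat_def)
  have "bruhat_class n u' p = bruhat_class n u p"
    by (rule bruhat_class_cong) (use eq graded_bruhat_in_Eh[OF *(1)] in auto)
  then show "c = bruhat_class n u p" using * eq by simp
  show "u i \<in> carrier Eh" if "i < n" for i
    using graded_bruhat_in_Eh[OF *(1) that] eq(2)[OF that] by simp
qed

lemma hdet_unique: "hdet n \<alpha> \<beta> A c \<Longrightarrow> hdet n \<alpha>' \<beta>' A d \<Longrightarrow> c = d"
  using hdet_bruhat unfolding hdet_def graded_bruhat_def by metis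

lemma hdet_cong:
  assumes "\<And>x y. x < n \<Longrightarrow> y < n \<Longrightarrow> A x y = B x y"
  shows "hdet n \<alpha> \<beta> A c \<longleftrightarrow> hdet n \<alpha> \<beta> B c"
  using assms by (simp add: hdet_def graded_bruhat_def bruhat_def)

lemma graded_mat_fmul:
  "graded_mat n \<alpha> \<beta> A \<Longrightarrow> graded_mat n \<beta> \<gamma> B \<Longrightarrow> graded_mat n \<alpha> \<gamma> (fmul n A B)"
  unfolding graded_mat_def fmul_def
  by (intro allI impI sum_component mult_component'[of _ "\<beta> k - \<alpha> x" _ "\<gamma> y - \<beta> k" for k x y]) auto

lemma hdet_lower:
  assumes "hdet n \<alpha> \<beta> A c" "unilow n S" "graded_mat n \<alpha> \<alpha> S"
  shows "hdet n \<alpha> \<beta> (fmul n S A) c"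
proof -
  obtain T u p V where *: "graded_bruhat n \<alpha> \<beta> A T u p V" "c = bruhat_class n u p"
    using assms(1) by (auto simp: hdet_def)
  have "fmul n S A x y = (\<Sum>i<n. fmul n S T x i * u i * V (p i) y)" if "x < n" "y < n" for x y
  proof -
    have "fmul n S A x y = fmul n S (fmul n T (\<lambda>i y. u i * V (p i) y)) x y"
      unfolding fmul_def[of n S] using * that
      by (intro sum.cong) (auto simp: graded_bruhat_def bruhat_def fmul_def mult.assoc)
    then show ?thesis by (simp add: fmul_assoc[symmetric]) (simp add: fmul_def mult.assoc)
  qed
  then have "graded_bruhat n \<alpha> \<beta> (fmul n S A) (fmul n S T) u p V"
    using * assms by (auto simp: graded_bruhat_def bruhat_def intro: unilow_fmul graded_mat_fmul)
  then show ?thesis using * by (auto simp: hdet_def)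
qed

text \<open>With \<open>D = diag(d)\<close>, \<open>D T = (D T D^-1) D\<close>: the conjugate is
  again lower unipotent, and pivot \<open>i\<close> is multiplied by \<open>d i\<close>, whose
  degree moves the row shift from \<open>\<alpha> i\<close> to \<open>\<alpha>' i\<close>.\<close>

lemma hdet_diag:
  assumes A: "hdet n \<alpha> \<beta> A c" and d: "\<And>i. i < n \<Longrightarrow> d i \<noteq> 0 \<and> d i \<in> E (\<alpha> i - \<alpha>' i)"
  shows "hdet n \<alpha>' \<beta> (\<lambda>x y. d x * A x y) (finprod Ab (\<lambda>i. cls (d i)) {..<n} \<otimes>\<^bsub>Ab\<^esub> c)"
proof -
  obtain T u p V where *: "graded_bruhat n \<alpha> \<beta> A T u p V" "c = bruhat_class n u p"
    using assms(1) by (auto simp: hdet_def)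
  have dE: "d i \<in> carrier Eh" if "i < n" for i using d[OF that] by (auto simp: Eh_carrier_iff)
  have uE: "u i \<in> carrier Eh" if "i < n" for i using * that graded_bruhat_in_Eh by blast
  define T' where "T' = (\<lambda>x i. d x * T x i * inv\<^bsub>Eh\<^esub> (d i))"
  have "unilow n T'"
    using * dE by (auto simp: graded_bruhat_def bruhat_def unilow_def T'_def)
  moreover have "graded_mat n \<alpha>' \<alpha>' T'"
    unfolding graded_mat_def T'_def
  proof (intro allI impI)
    fix x y assume xy: "x < n" "y < n"
    have "d x * T x y \<in> E (\<alpha> y - \<alpha>' x)"
      by (rule mult_component'[of _ "\<alpha> x - \<alpha>' x" _ "\<alpha> y - \<alpha> x"])
        (use d * xy in \<open>auto simp: graded_bruhat_def graded_mat_def\<close>)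
    then show "d x * T x y * inv\<^bsub>Eh\<^esub> (d y) \<in> E (\<alpha>' y - \<alpha>' x)"
      by (rule mult_component'[OF _ hinv_component[of _ "\<alpha> y - \<alpha>' y"]]) (use d xy in auto)
  qed
  moreover have "d i * u i \<in> E (\<beta> (p i) - \<alpha>' i) \<and> d i * u i \<noteq> 0" if "i < n" for i
    using mult_component'[of "d i" "\<alpha> i - \<alpha>' i" "u i" "\<beta> (p i) - \<alpha> i" "\<beta> (p i) - \<alpha>' i"]
      mult_homogeneous_nonzero[of "d i" "\<alpha> i - \<alpha>' i" "u i"] d[OF that] * that
    by (auto simp: graded_bruhat_def bruhat_def)
  moreover have "d x * A x y = (\<Sum>i<n. T' x i * (d i * u i) * V (p i) y)" if "x < n" "y < n" for x y
    using * that dE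
    by (auto simp: graded_bruhat_def bruhat_def T'_def sum_distrib_left mult.assoc intro!: sum.cong)
  ultimately have "graded_bruhat n \<alpha>' \<beta> (\<lambda>x y. d x * A x y) T' (\<lambda>i. d i * u i) p V"
    using * by (auto simp: graded_bruhat_def bruhat_def)
  moreover have "finprod Ab (\<lambda>i. cls (d i)) {..<n} \<otimes>\<^bsub>Ab\<^esub> c = bruhat_class n (\<lambda>i. d i * u i) p"
  proof -
    have "finprod Ab (\<lambda>i. cls (d i * u i)) {..<n} = finprod Ab (\<lambda>i. cls (d i) \<otimes>\<^bsub>Ab\<^esub> cls (u i)) {..<n}"
      by (rule Ab.finprod_cong') (use dE uE cls_mult in auto)
    also have "\<dots> = finprod Ab (\<lambda>i. cls (d i)) {..<n} \<otimes>\<^bsub>Ab\<^esub> finprod Ab (\<lambda>i. cls (u i)) {..<n}"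
      by (rule Ab.finprod_multf) (use dE uE in auto)
    finally show ?thesis using * dE uE by (simp add: bruhat_class_def Ab.m_lcomm Pi_iff)
  qed
  ultimately show ?thesis by (auto simp: hdet_def)
qed


lemma finprod_remove_adjacent:
  assumes "Suc m < n" "\<And>i. i < n \<Longrightarrow> f i \<in> carrier Ab"
  shows "finprod Ab f {..<n} =
    (f m \<otimes>\<^bsub>Ab\<^esub> f (Suc m)) \<otimes>\<^bsub>Ab\<^esub> finprod Ab f ({..<n} - {m, Suc m})"
proof -
  have "{..<n} = insert m (insert (Suc m) ({..<n} - {m, Suc m}))" using assms by auto
  then have "finprod Ab f {..<n} = finprod Ab f (insert m (insert (Suc m) ({..<n} - {m, Suc m})))"
    by simp
  also have "\<dots> = (f m \<otimes>\<^bsub>Ab\<^esub> f (Suc m)) \<otimes>\<^bsub>Ab\<^esub> finprod Ab f ({..<n} - {m, Suc m})"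
    using assms by (simp add: Ab.m_assoc Pi_iff)
  finally show ?thesis .
qed

text \<open>With \<open>a = T (Suc m) m\<close>, the matrix \<open>T\<close> is a lower unipotent matrix that stays so after the exchange,
  times \<open>1 + a e\<close> for the elementary matrix \<open>e\<close> at \<open>(Suc m, m)\<close>. If \<open>p (Suc m) < p m\<close>, then \<open>1 + a e\<close>
  moves through \<open>U P\<^sub>\<pi>\<close> into \<open>V\<close>. Otherwise, for \<open>a \<noteq> 0\<close>, the block \<open>((a, 1), (1, 0))\<close> of the exchange
  times \<open>1 + a e\<close> is lower unipotent times \<open>diag(a, -1/a)\<close> times upper unipotent, and the last
  factor moves into \<open>V\<close>.\<close>

lemma hdet_swap_adjacent:
  assumes A: "hdet n \<alpha> \<beta> A c" and m: "Suc m < n"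
  defines "s \<equiv> Transposition.transpose m (Suc m)"
  shows "hdet n (\<alpha> \<circ> s) \<beta> (\<lambda>x. A (s x)) (cls (- 1) \<otimes>\<^bsub>Ab\<^esub> c)"
proof -
  obtain T u p V where *: "graded_bruhat n \<alpha> \<beta> A T u p V" and c: "c = bruhat_class n u p"
    using A by (auto simp: hdet_def)
  have T: "T i i = 1" "x < i \<Longrightarrow> T x i = 0" "T x i \<in> E (\<alpha> i - \<alpha> x)" if "i < n" "x < n" for x i
    using * that by (auto simp: graded_bruhat_def bruhat_def unilow_def graded_mat_def)
  have V: "V i i = 1" "y < i \<Longrightarrow> V i y = 0" "V i y \<in> E (\<beta> y - \<beta> i)" if "i < n" "y < n" for y i
    using * that by (auto simp: graded_bruhat_def bruhat_def uniup_def graded_mat_def)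
  have u: "u i \<noteq> 0" "u i \<in> E (\<beta> (p i) - \<alpha> i)" "u i \<in> carrier Eh" if "i < n" for i
    using * that graded_bruhat_in_Eh[OF *] by (auto simp: graded_bruhat_def bruhat_def)
  have p: "p permutes {..<n}" using * by (auto simp: graded_bruhat_def bruhat_def)
  then have pn: "p i < n" if "i < n" for i using that permutes_in_image[of p "{..<n}" i] by auto
  have p_inj: "p i = p j \<longleftrightarrow> i = j" for i j
    using p by (metis permutes_inj_on inj_onD UNIV_I)
  have sum: "A x y = (\<Sum>i<n. T x i * u i * V (p i) y)" if "x < n" "y < n" for x y
    using * that by (auto simp: graded_bruhat_def bruhat_def)
  have s: "s m = Suc m" "s (Suc m) = m" "\<And>i. i \<noteq> m \<Longrightarrow> i \<noteq> Suc m \<Longrightarrow> s i = i"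
    by (auto simp: s_def)
  have sn: "s i < n" if "i < n" for i
    using that m by (auto simp: s_def Transposition.transpose_def)
  have s_perm: "s permutes {..<n}" using m unfolding s_def by (intro permutes_swap_id) auto
  have s_less: "s x < i" if "x < i" "i \<noteq> m" "i \<noteq> Suc m" for x i
    using that by (auto simp: s_def Transposition.transpose_def)
  define a where "a = T (Suc m) m"
  have aE: "a \<in> E (\<alpha> m - \<alpha> (Suc m))" using T(3)[of m "Suc m"] m by (simp add: a_def)
  have mn: "m < n" using m by simp
  \<comment> \<open>Column \<open>m\<close> of \<open>T (1 - a e)\<close> with its rows exchanged:
    subtracting column \<open>Suc m\<close> times \<open>a\<close> removes the entry
    \<open>a\<close>, which the exchange would otherwise carry to the diagonal.\<close>
  define T0 where "T0 = (\<lambda>x. T (s x) m - T (s x) (Suc m) * a)"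
  have T0: "T0 x \<in> E (\<alpha> m - \<alpha> (s x))" if "x < n" for x
    unfolding T0_def
    by (intro diff_component mult_component'[of _ "\<alpha> (Suc m) - \<alpha> (s x)" _ "\<alpha> m - \<alpha> (Suc m)"])
      (use T(3) aE sn[OF that] m mn in auto)
  have T0': "T0 (Suc m) = 1" "x \<le> m \<Longrightarrow> T0 x = 0" for x
    using T(1,2) m mn s_less[of x] by (cases "x = m"; simp add: T0_def s a_def)+
  show ?thesis
  proof (cases "a = 0 \<or> p (Suc m) < p m")
    case True
    \<comment> \<open>Chosen so that \<open>u (Suc m) * b = a * u m\<close>, that is,
      \<open>(1 + a e) U = U (1 + b e)\<close>. Behind the permutation, \<open>b\<close> sits at
      \<open>(p (Suc m), p m)\<close>, above the diagonal by the case assumption unless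
      \<open>a = 0\<close>.\<close>
    define b where "b = inv\<^bsub>Eh\<^esub> (u (Suc m)) * a * u m"
    define T1 where "T1 = (\<lambda>x i. if i = m then T (s x) (Suc m)
      else if i = Suc m then T0 x else T (s x) i)"
    define V1 where "V1 = (\<lambda>r y. if r = p (Suc m) then V r y + b * V (p m) y else V r y)"
    have b0: "b \<in> E (\<beta> (p m) - \<beta> (p (Suc m)))"
      unfolding b_def
      by (rule mult_component'[OF mult_component'[OF hinv_component[OF u(2,1)] aE refl] u(2)])
        (use m mn in auto)
    have "unilow n T1"
      unfolding unilow_def T1_def
      using T(1,2) T0' m mn s sn s_less by auto
    moreover have "graded_mat n (\<alpha> \<circ> s) (\<alpha> \<circ> s) T1"
      unfolding graded_mat_def T1_def using T(3) T0 m mn s sn by auto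
    moreover have "uniup n V1"
      unfolding uniup_def V1_def
      using V(1,2) True pn[OF mn] pn[OF m] by (auto simp: b_def)
    moreover have "graded_mat n \<beta> \<beta> V1"
      unfolding graded_mat_def V1_def
      using V(3) pn[OF mn] pn[OF m] by (auto intro!: add_component mult_component'[OF b0])
    moreover have "p \<circ> s permutes {..<n}" using p s_perm by (rule permutes_compose[rotated])
    moreover have "(u \<circ> s) i \<in> E (\<beta> ((p \<circ> s) i) - (\<alpha> \<circ> s) i) \<and> (u \<circ> s) i \<noteq> 0" if "i < n" for i
      using u sn[OF that] by simp
    moreover have "A (s x) y = (\<Sum>i<n. T1 x i * (u \<circ> s) i * V1 ((p \<circ> s) i) y)"
      if "x < n" "y < n" for x y
    proof -
      have "(\<Sum>i\<in>{..<n} - {m, Suc m}. T1 x i * (u \<circ> s) i * V1 ((p \<circ> s) i) y)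
          = (\<Sum>i\<in>{..<n} - {m, Suc m}. T (s x) i * u i * V (p i) y)"
        by (rule sum.cong) (auto simp: s T1_def V1_def p_inj)
      moreover have "T1 x m * (u \<circ> s) m * V1 ((p \<circ> s) m) y
            + T1 x (Suc m) * (u \<circ> s) (Suc m) * V1 ((p \<circ> s) (Suc m)) y
          = T (s x) m * u m * V (p m) y + T (s x) (Suc m) * u (Suc m) * V (p (Suc m)) y"
        using u(3)[OF m] by (simp add: s T1_def T0_def V1_def p_inj b_def algebra_simps)
      ultimately show ?thesis
        using that sn by (simp add: sum sum_remove_adjacent[OF m])
    qed
    ultimately have "graded_bruhat n (\<alpha> \<circ> s) \<beta> (\<lambda>x. A (s x)) T1 (u \<circ> s) (p \<circ> s) V1"
      by (simp add: graded_bruhat_def bruhat_def)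
    moreover have "cls (- 1) \<otimes>\<^bsub>Ab\<^esub> c = bruhat_class n (u \<circ> s) (p \<circ> s)"
    proof -
      \<comment> \<open>In this case the factor -1 comes from the permutation alone; the pivots are
        only reordered.\<close>
      have "sign (p \<circ> s) = - sign p"
        using p s_perm by (subst sign_compose) (auto simp: s_def sign_swap_id permutation_permutes)
      moreover have "finprod Ab (\<lambda>i. cls ((u \<circ> s) i)) {..<n} = finprod Ab (\<lambda>i. cls (u i)) {..<n}"
        using Ab.finprod_reindex[of "\<lambda>i. cls (u i)" s "{..<n}"] s_perm u
        by (auto simp: permutes_image permutes_inj_on Pi_iff)
      ultimately show ?thesis
        using u by (simp add: c bruhat_class_def cls_minus Ab.m_assoc Pi_iff)
    qed
    ultimately show ?thesis by (auto simp: hdet_def)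
  next
    case False
    then have a0: "a \<noteq> 0" and less: "p m < p (Suc m)"
      using p_inj[of "Suc m" m] by auto
    have a: "a \<in> carrier Eh" using aE a0 by (auto simp: Eh_carrier_iff)
    let ?a' = "inv\<^bsub>Eh\<^esub> a"
    have a'E: "?a' \<in> E (\<alpha> (Suc m) - \<alpha> m)" using hinv_component[OF aE a0] by simp
    \<comment> \<open>The upper factor of the block has entry \<open>1/a\<close> at
      \<open>(m, Suc m)\<close>. Moving it through \<open>U\<close> requires
      \<open>u m * b = ?a' * u (Suc m)\<close>, and \<open>less\<close> places \<open>b\<close>
      above the diagonal.\<close>
    define b where "b = inv\<^bsub>Eh\<^esub> (u m) * ?a' * u (Suc m)"
    \<comment> \<open>Absorbing the lower factor of the block turns column \<open>m\<close> into
      \<open>T (s x) (Suc m) + T0 x * ?a'\<close>, where the two terms with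
      \<open>T (s x) (Suc m)\<close> cancel.\<close>
    define T1 where "T1 = (\<lambda>x i. if i = m then T (s x) m * ?a'
      else if i = Suc m then T0 x else T (s x) i)"
    define V1 where "V1 = (\<lambda>r y. if r = p m then V r y + b * V (p (Suc m)) y else V r y)"
    define u1 where "u1 = (\<lambda>i. if i = m then a * u m else if i = Suc m then - (?a' * u (Suc m)) else u i)"
    have b0: "b \<in> E (\<beta> (p (Suc m)) - \<beta> (p m))"
      unfolding b_def
      by (rule mult_component'[OF mult_component'[OF hinv_component[OF u(2,1)] a'E refl] u(2)])
        (use m mn in auto)
    have "unilow n T1"
      unfolding unilow_def T1_def
      using T(1,2) T0' m mn s sn s_less a by (auto simp: a_def)
    moreover have "graded_mat n (\<alpha> \<circ> s) (\<alpha> \<circ> s) T1"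
    proof -
      have "T (s x) m * ?a' \<in> E (\<alpha> (Suc m) - \<alpha> (s x))" if "x < n" for x
        by (rule mult_component'[OF T(3) a'E]) (use sn[OF that] mn in auto)
      then show ?thesis
        unfolding graded_mat_def T1_def using T(3) T0 m mn s sn by auto
    qed
    moreover have "uniup n V1"
      unfolding uniup_def V1_def
      using V(1,2) less pn[OF mn] pn[OF m] by (auto simp: b_def)
    moreover have "graded_mat n \<beta> \<beta> V1"
      unfolding graded_mat_def V1_def
      using V(3) pn[OF mn] pn[OF m] by (auto intro!: add_component mult_component'[OF b0])
    moreover have "u1 i \<in> E (\<beta> (p i) - (\<alpha> \<circ> s) i) \<and> u1 i \<noteq> 0" if "i < n" for i
    proof -
      have "a * u m \<in> E (\<beta> (p m) - \<alpha> (Suc m))"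
        by (rule mult_component'[OF aE u(2)[OF mn]]) simp
      moreover have "?a' * u (Suc m) \<in> E (\<beta> (p (Suc m)) - \<alpha> m)"
        by (rule mult_component'[OF a'E u(2)[OF m]]) simp
      moreover have "a * u m \<noteq> 0" "?a' * u (Suc m) \<noteq> 0"
        using mult_homogeneous_nonzero[OF aE a0] mult_homogeneous_nonzero[OF a'E] a u m mn by auto
      ultimately show ?thesis
        using u that by (auto simp: u1_def s uminus_component)
    qed
    moreover have "A (s x) y = (\<Sum>i<n. T1 x i * u1 i * V1 (p i) y)"
      if "x < n" "y < n" for x y
    proof -
      have "(\<Sum>i\<in>{..<n} - {m, Suc m}. T1 x i * u1 i * V1 (p i) y)
          = (\<Sum>i\<in>{..<n} - {m, Suc m}. T (s x) i * u i * V (p i) y)"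
        by (rule sum.cong) (auto simp: s T1_def V1_def p_inj u1_def)
      moreover have "T1 x m * u1 m * V1 (p m) y + T1 x (Suc m) * u1 (Suc m) * V1 (p (Suc m)) y
          = T (s x) m * u m * V (p m) y + T (s x) (Suc m) * u (Suc m) * V (p (Suc m)) y"
        using u(3)[OF mn] a by (simp add: s T1_def T0_def V1_def u1_def p_inj b_def algebra_simps)
      ultimately show ?thesis
        using that sn by (simp add: sum sum_remove_adjacent[OF m])
    qed
    ultimately have "graded_bruhat n (\<alpha> \<circ> s) \<beta> (\<lambda>x. A (s x)) T1 u1 p V1"
      using p by (simp add: graded_bruhat_def bruhat_def)
    moreover have "cls (- 1) \<otimes>\<^bsub>Ab\<^esub> c = bruhat_class n u1 p"
    proof -
      have [simp]: "?a' * u (Suc m) \<in> carrier Eh" "a * u m \<in> carrier Eh"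
        using Eh.m_closed[of ?a' "u (Suc m)"] Eh.m_closed[of a "u m"] a u m mn by auto
      have u1E: "u1 i \<in> carrier Eh" if "i < n" for i
        using u that Eh.m_closed[of "- 1" "?a' * u (Suc m)"] by (auto simp: u1_def)
      have a'cls: "cls a \<otimes>\<^bsub>Ab\<^esub> cls ?a' = \<one>\<^bsub>Ab\<^esub>"
        using a by (simp flip: cls_mult)
      \<comment> \<open>Here \<open>p\<close> is unchanged and the sign comes from the pivots:
        \<open>a\<close> and its inverse cancel in the abelianization, leaving the class of
        -1.\<close>
      have "cls (u1 m) \<otimes>\<^bsub>Ab\<^esub> cls (u1 (Suc m))
          = (cls a \<otimes>\<^bsub>Ab\<^esub> cls (u m)) \<otimes>\<^bsub>Ab\<^esub> (cls (- 1) \<otimes>\<^bsub>Ab\<^esub> (cls ?a' \<otimes>\<^bsub>Ab\<^esub> cls (u (Suc m))))"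
        using a u m mn by (simp add: u1_def cls_minus cls_mult)
      also have "\<dots> = (cls a \<otimes>\<^bsub>Ab\<^esub> cls ?a') \<otimes>\<^bsub>Ab\<^esub> (cls (- 1) \<otimes>\<^bsub>Ab\<^esub> (cls (u m) \<otimes>\<^bsub>Ab\<^esub> cls (u (Suc m))))"
        using a u m mn by (simp add: Ab.m_ac)
      finally have *: "cls (u1 m) \<otimes>\<^bsub>Ab\<^esub> cls (u1 (Suc m))
          = cls (- 1) \<otimes>\<^bsub>Ab\<^esub> (cls (u m) \<otimes>\<^bsub>Ab\<^esub> cls (u (Suc m)))"
        using a u m mn a'cls by simp
      have "finprod Ab (\<lambda>i. cls (u1 i)) ({..<n} - {m, Suc m})
          = finprod Ab (\<lambda>i. cls (u i)) ({..<n} - {m, Suc m})"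
        by (rule Ab.finprod_cong') (use u in \<open>auto simp: u1_def\<close>)
      then have "finprod Ab (\<lambda>i. cls (u1 i)) {..<n} = cls (- 1) \<otimes>\<^bsub>Ab\<^esub> finprod Ab (\<lambda>i. cls (u i)) {..<n}"
        using u u1E * m mn by (simp add: finprod_remove_adjacent[OF m] Ab.m_assoc Pi_iff)
      then show ?thesis
        using u by (simp add: c bruhat_class_def Ab.m_lcomm Pi_iff)
    qed
    ultimately show ?thesis by (auto simp: hdet_def)
  qed
qed

end


section \<open>Multiplicativity and existence\<close>

context graded_division_ring
begin

lemma cls_minus_one_square: "cls (- 1) \<otimes>\<^bsub>Ab\<^esub> cls (- 1) = \<one>\<^bsub>Ab\<^esub>"
  using cls_mult[of "- 1" "- 1"] by simp

text \<open>Conjugating the transposition \<open>(a b)\<close> by the adjacent exchange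
  \<open>(b, Suc b)\<close> gives \<open>(a, Suc b)\<close>; the three factors -1 reduce to
  one.\<close>

lemma hdet_transpose_less:
  assumes "hdet n \<alpha> \<beta> A c" "a + Suc d < n"
  shows "hdet n (\<alpha> \<circ> Transposition.transpose a (a + Suc d)) \<beta>
    (\<lambda>x. A (Transposition.transpose a (a + Suc d) x)) (cls (- 1) \<otimes>\<^bsub>Ab\<^esub> c)"
  using assms
proof (induction d arbitrary: \<alpha> A c)
  case 0
  then show ?case using hdet_swap_adjacent[of n \<alpha> \<beta> A c a] by (simp add: comp_def)
next
  case (Suc d)
  define b where "b = a + Suc d"
  define s where "s = Transposition.transpose b (Suc b)"
  define t where "t = Transposition.transpose a b"
  have b: "Suc b < n" "a + Suc d < n" using Suc.prems by (auto simp: b_def)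
  have c: "c \<in> carrier Ab" using Suc.prems by (auto dest: hdet_in_Ab)
  have "hdet n (\<alpha> \<circ> s) \<beta> (\<lambda>x. A (s x)) (cls (- 1) \<otimes>\<^bsub>Ab\<^esub> c)"
    unfolding s_def by (rule hdet_swap_adjacent[OF Suc.prems(1) b(1)])
  from Suc.IH[OF this b(2)]
  have "hdet n (\<alpha> \<circ> s \<circ> t) \<beta> (\<lambda>x. A (s (t x))) (cls (- 1) \<otimes>\<^bsub>Ab\<^esub> (cls (- 1) \<otimes>\<^bsub>Ab\<^esub> c))"
    by (simp add: t_def b_def comp_def)
  from hdet_swap_adjacent[OF this b(1)]
  have "hdet n (\<alpha> \<circ> s \<circ> t \<circ> s) \<beta> (\<lambda>x. A (s (t (s x))))
      (cls (- 1) \<otimes>\<^bsub>Ab\<^esub> (cls (- 1) \<otimes>\<^bsub>Ab\<^esub> (cls (- 1) \<otimes>\<^bsub>Ab\<^esub> c)))"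
    by (simp add: s_def comp_def)
  moreover have "s (t (s x)) = Transposition.transpose a (a + Suc (Suc d)) x" for x
    by (auto simp: s_def t_def b_def Transposition.transpose_def)
  moreover have "cls (- 1) \<otimes>\<^bsub>Ab\<^esub> (cls (- 1) \<otimes>\<^bsub>Ab\<^esub> c) = c"
    using c by (simp add: cls_minus_one_square flip: Ab.m_assoc)
  ultimately show ?case by (simp add: comp_def)
qed

lemma hdet_transpose:
  assumes "hdet n \<alpha> \<beta> A c" "a < n" "b < n" "a \<noteq> b"
  shows "hdet n (\<alpha> \<circ> Transposition.transpose a b) \<beta>
    (\<lambda>x. A (Transposition.transpose a b x)) (cls (- 1) \<otimes>\<^bsub>Ab\<^esub> c)"
proof (cases "a < b")
  case True
  then obtain d where "b = a + Suc d" by (metis less_iff_Suc_add add_Suc_right)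
  then show ?thesis using hdet_transpose_less assms by metis
next
  case False
  then obtain d where "a = b + Suc d" using assms by (metis linorder_neqE_nat less_iff_Suc_add add_Suc_right)
  then show ?thesis using hdet_transpose_less assms transpose_commute by metis
qed

lemma hdet_permute_rows:
  assumes "hdet n \<alpha> \<beta> A c" "p permutes {..<n}"
  shows "hdet n (\<alpha> \<circ> p) \<beta> (\<lambda>x. A (p x)) (cls (of_int (sign p)) \<otimes>\<^bsub>Ab\<^esub> c)"
  using assms(2) finite_lessThan assms(1)
proof (induction arbitrary: \<alpha> A c rule: permutes_induct)
  case id
  then show ?case using hdet_in_Ab[OF id] by simp
next
  case (swap a b p)
  have c: "c \<in> carrier Ab" using swap.prems by (rule hdet_in_Ab)
  have "cls (of_int (sign (Transposition.transpose a b \<circ> p))) = cls (- 1) \<otimes>\<^bsub>Ab\<^esub> cls (of_int (sign p))"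
    using swap.hyps permutes_imp_permutation[OF finite_lessThan swap.hyps(4)]
    by (simp add: sign_compose permutation_swap_id sign_swap_id cls_minus)
  then show ?case
    using swap.IH[OF hdet_transpose[OF swap.prems, of a b]] swap.hyps c
    by (simp add: comp_def Ab.m_ac)
qed

lemma hdet_upper:
  assumes B: "hdet n \<beta> \<gamma> B d" and V: "uniup n V" "graded_mat n \<beta> \<beta> V"
  shows "hdet n \<beta> \<gamma> (fmul n V B) d"
proof -
  \<comment> \<open>The order reversal, continued by the identity so that
    \<open>r permutes {..<n}\<close>. It is applied before and after the lower matrix
    \<open>T\<close>, so its sign occurs twice and cancels.\<close>
  define r where "r = (\<lambda>i. if i < n then n - Suc i else i)"
  define T where "T = (\<lambda>x y. V (r x) (r y))"
  have r: "r (r i) = i" for i by (simp add: r_def)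
  have rn: "r i < n \<longleftrightarrow> i < n" for i by (auto simp: r_def)
  have r_perm: "r permutes {..<n}"
  proof (rule bij_imp_permutes)
    show "bij_betw r {..<n} {..<n}"
      by (rule bij_betwI[of _ _ _ r]) (auto simp: r rn)
  qed (simp add: r_def)
  have "unilow n T"
    using V by (auto simp: uniup_iff_unilow_reverse unilow_def T_def r_def)
  moreover have "graded_mat n (\<beta> \<circ> r) (\<beta> \<circ> r) T"
    using V rn by (auto simp: graded_mat_def T_def)
  ultimately have "hdet n (\<beta> \<circ> r) \<gamma> (fmul n T (\<lambda>x. B (r x))) (cls (of_int (sign r)) \<otimes>\<^bsub>Ab\<^esub> d)"
    using hdet_lower[OF hdet_permute_rows[OF B r_perm]] by blast
  from hdet_permute_rows[OF this r_perm]
  have "hdet n (\<beta> \<circ> r \<circ> r) \<gamma> (\<lambda>x. fmul n T (\<lambda>x. B (r x)) (r x))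
      (cls (of_int (sign r)) \<otimes>\<^bsub>Ab\<^esub> (cls (of_int (sign r)) \<otimes>\<^bsub>Ab\<^esub> d))" .
  moreover have "(\<lambda>x. fmul n T (\<lambda>x. B (r x)) (r x)) = fmul n V B"
    using sum.permute[OF r_perm, of "\<lambda>k. V x k * B k y" for x y]
    by (intro ext) (simp add: fmul_def T_def r comp_def)
  moreover have "cls (of_int (sign r)) \<otimes>\<^bsub>Ab\<^esub> (cls (of_int (sign r)) \<otimes>\<^bsub>Ab\<^esub> d) = d"
    using hdet_in_Ab[OF B] by (simp flip: Ab.m_assoc cls_mult of_int_mult)
  ultimately show ?thesis by (simp add: comp_def r)
qed

lemma hdet_fmul:
  assumes A: "hdet n \<alpha> \<beta> A c" and B: "hdet n \<beta> \<gamma> B d"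
  shows "hdet n \<alpha> \<gamma> (fmul n A B) (c \<otimes>\<^bsub>Ab\<^esub> d)"
proof -
  obtain T u p V where *: "graded_bruhat n \<alpha> \<beta> A T u p V" "c = bruhat_class n u p"
    using A by (auto simp: hdet_def)
  note b = *(1)[unfolded graded_bruhat_def bruhat_def]
  have u: "u i \<in> carrier Eh" if "i < n" for i using graded_bruhat_in_Eh * that by blast
  \<comment> \<open>\<open>A B = T (U (P (V B)))\<close> is built from the inside. \<open>V\<close>
    and \<open>T\<close> keep the class, \<open>P\<close> contributes the sign of \<open>p\<close>,
    \<open>U\<close> its pivots; the row shift runs through \<beta>, \<beta> \<circ>
    \<open>p\<close> and \<alpha>.\<close>
  have "hdet n \<beta> \<gamma> (fmul n V B) d" using B b by (intro hdet_upper) auto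
  then have "hdet n (\<beta> \<circ> p) \<gamma> (\<lambda>i. fmul n V B (p i)) (cls (of_int (sign p)) \<otimes>\<^bsub>Ab\<^esub> d)"
    using b by (intro hdet_permute_rows) auto
  then have "hdet n \<alpha> \<gamma> (\<lambda>i y. u i * fmul n V B (p i) y)
      (finprod Ab (\<lambda>i. cls (u i)) {..<n} \<otimes>\<^bsub>Ab\<^esub> (cls (of_int (sign p)) \<otimes>\<^bsub>Ab\<^esub> d))"
    using b by (intro hdet_diag) auto
  then have "hdet n \<alpha> \<gamma> (fmul n T (\<lambda>i y. u i * fmul n V B (p i) y))
      (finprod Ab (\<lambda>i. cls (u i)) {..<n} \<otimes>\<^bsub>Ab\<^esub> (cls (of_int (sign p)) \<otimes>\<^bsub>Ab\<^esub> d))"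
    using b by (intro hdet_lower) auto
  moreover have eq: "fmul n T (\<lambda>i y. u i * fmul n V B (p i) y) x y = fmul n A B x y" if "x < n" for x y
  proof -
    have "fmul n T (\<lambda>i y. u i * fmul n V B (p i) y) x y
        = fmul n T (fmul n (\<lambda>i k. u i * V (p i) k) B) x y"
      by (simp add: fmul_def sum_distrib_left mult.assoc)
    also have "\<dots> = fmul n (fmul n T (\<lambda>i k. u i * V (p i) k)) B x y" by (simp add: fmul_assoc)
    also have "\<dots> = fmul n A B x y"
      unfolding fmul_def[of n _ B] using b that
      by (intro sum.cong) (auto simp: fmul_def mult.assoc)
    finally show ?thesis .
  qed
  moreover have "finprod Ab (\<lambda>i. cls (u i)) {..<n} \<otimes>\<^bsub>Ab\<^esub> (cls (of_int (sign p)) \<otimes>\<^bsub>Ab\<^esub> d) = c \<otimes>\<^bsub>Ab\<^esub> d"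
    using * u hdet_in_Ab[OF B] by (simp add: bruhat_class_def Ab.m_ac Pi_iff)
  ultimately show ?thesis by (simp add: hdet_cong[OF eq])
qed

lemma hdet_one: "hdet n \<alpha> \<alpha> (\<lambda>x y. if x = y then 1 else 0) \<one>\<^bsub>Ab\<^esub>"
proof -
  let ?I = "\<lambda>x y. if x = y then 1 else (0 :: 'b)"
  have "graded_bruhat n \<alpha> \<alpha> ?I ?I (\<lambda>_. 1) id ?I"
    by (auto simp: graded_bruhat_def bruhat_def unilow_def uniup_def graded_mat_def permutes_id
        one_component zero_component sum_delta_left)
  moreover have "bruhat_class n (\<lambda>_. 1) id = \<one>\<^bsub>Ab\<^esub>"
    by (simp add: bruhat_class_def)
  ultimately show ?thesis unfolding hdet_def by metis
qed

section \<open>Existence of the decomposition\<close>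

text \<open>The state of Gaussian elimination after clearing the rows \<open>0, \<dots>, m - 1\<close>: the matrix \<open>A\<close> is a sum
  of \<open>m\<close> products of a column, a pivot and a row, plus a remainder \<open>R\<close> vanishing on the cleared
  rows and pivot columns. The pivot \<open>q i\<close> is the leftmost nonzero entry of row \<open>i\<close>.\<close>

definition partial_bruhat where
  "partial_bruhat n \<alpha> \<beta> A m t u q v R \<longleftrightarrow>
     (\<forall>i<m. q i < n) \<and> inj_on q {..<m} \<and> (\<forall>i<m. u i \<noteq> 0 \<and> u i \<in> E (\<beta> (q i) - \<alpha> i)) \<and>
     (\<forall>i<m. t i i = 1 \<and> (\<forall>x<i. t x i = 0) \<and> (\<forall>x<n. t x i \<in> E (\<alpha> i - \<alpha> x))) \<and>
     (\<forall>i<m. v i (q i) = 1 \<and> (\<forall>y<q i. v i y = 0) \<and> (\<forall>j<i. v i (q j) = 0) \<and>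
        (\<forall>y<n. v i y \<in> E (\<beta> y - \<beta> (q i)))) \<and>
     graded_mat n \<alpha> \<beta> R \<and> (\<forall>x<m. \<forall>y<n. R x y = 0) \<and> (\<forall>i<m. \<forall>x<n. R x (q i) = 0) \<and>
     (\<forall>x<n. \<forall>y<n. A x y = (\<Sum>i<m. t x i * u i * v i y) + R x y)"

text \<open>If row \<open>m\<close> of \<open>R\<close> vanished, rows 0 to \<open>m\<close> of
  \<open>A\<close> would be combinations of the \<open>m\<close> rows \<open>v i\<close>. Testing
  against \<open>z\<close>, column \<open>m\<close> of a right inverse, the rows above
  \<open>m\<close> give a triangular homogeneous system for the products \<open>s i\<close> of
  \<open>v i\<close> with \<open>z\<close>. So all \<open>s i\<close> vanish, and row
  \<open>m\<close> reads 1 = 0.\<close>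

lemma partial_bruhat_pivot:
  assumes "partial_bruhat n \<alpha> \<beta> A m t u q v R" and m: "m < n"
    and Z: "\<And>x. x < n \<Longrightarrow> (\<Sum>y<n. A x y * z y) = (if x = m then 1 else 0)"
  shows "\<exists>y<n. R m y \<noteq> 0"
proof (rule ccontr)
  assume R: "\<not> (\<exists>y<n. R m y \<noteq> 0)"
  note b = assms(1)[unfolded partial_bruhat_def]
  define s where "s = (\<lambda>i. \<Sum>y<n. v i y * z y)"
  have eq: "(if x = m then 1 else 0) = (\<Sum>i<m. t x i * u i * s i)" if "x \<le> m" for x
  proof -
    have "R x y = 0" if "y < n" for y using b R that \<open>x \<le> m\<close> by (cases "x = m") auto
    then have "(if x = m then 1 else 0) = (\<Sum>y<n. \<Sum>i<m. t x i * u i * v i y * z y)"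
      using Z[of x] b that m by (simp add: sum_distrib_right)
    also have "\<dots> = (\<Sum>i<m. t x i * u i * s i)"
      by (subst sum.swap) (simp add: s_def sum_distrib_left mult.assoc)
    finally show ?thesis .
  qed
  have s0: "s x = 0" if "x < m" for x
    using that
  proof (induction x rule: less_induct)
    case (less x)
    have "(\<Sum>i<m. t x i * u i * s i) = (\<Sum>i\<in>{x}. t x i * u i * s i)"
    proof (rule sum.mono_neutral_right)
      show "\<forall>i\<in>{..<m} - {x}. t x i * u i * s i = 0"
      proof
        fix i assume "i \<in> {..<m} - {x}"
        then show "t x i * u i * s i = 0" using less b by (cases "i < x") auto
      qed
    qed (use less in auto)
    then have "u x * s x = 0" using eq[of x] less.prems b by simp
    \<comment> \<open>\<open>s x\<close> may be inhomogeneous; it is enough that the left factor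
      \<open>u x\<close> is homogeneous and nonzero, hence a unit.\<close>
    then show ?case
      using mult_homogeneous_nonzero[of "u x" "\<beta> (q x) - \<alpha> x" "s x"] b less.prems by auto
  qed
  then show False using eq[of m] by simp
qed

lemma partial_bruhat_step:
  assumes P: "partial_bruhat n \<alpha> \<beta> A m t u q v R" and m: "m < n" and ex: "\<exists>y<n. R m y \<noteq> 0"
  shows "\<exists>t u q v R. partial_bruhat n \<alpha> \<beta> A (Suc m) t u q v R"
proof -
  have bq: "\<forall>i<m. q i < n" and binj: "inj_on q {..<m}"
    and bu: "\<forall>i<m. u i \<noteq> 0 \<and> u i \<in> E (\<beta> (q i) - \<alpha> i)"
    and bt: "\<forall>i<m. t i i = 1 \<and> (\<forall>x<i. t x i = 0) \<and> (\<forall>x<n. t x i \<in> E (\<alpha> i - \<alpha> x))"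
    and bv: "\<forall>i<m. v i (q i) = 1 \<and> (\<forall>y<q i. v i y = 0) \<and> (\<forall>j<i. v i (q j) = 0) \<and>
        (\<forall>y<n. v i y \<in> E (\<beta> y - \<beta> (q i)))"
    and bR: "graded_mat n \<alpha> \<beta> R" and bR0: "\<forall>x<m. \<forall>y<n. R x y = 0"
    and bRq: "\<forall>i<m. \<forall>x<n. R x (q i) = 0"
    and bA: "\<forall>x<n. \<forall>y<n. A x y = (\<Sum>i<m. t x i * u i * v i y) + R x y"
    using P by (auto simp: partial_bruhat_def)
  \<comment> \<open>Taking the leftmost nonzero entry makes the new row \<open>v' m\<close> vanish
    to the left of its pivot, which later becomes upper triangularity of \<open>V\<close>.\<close>
  define k where "k = (LEAST y. y < n \<and> R m y \<noteq> 0)"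
  have k: "k < n" "R m k \<noteq> 0"
    using LeastI_ex[of "\<lambda>y. y < n \<and> R m y \<noteq> 0"] ex by (auto simp: k_def)
  have k_least: "R m y = 0" if "y < k" for y
    using not_less_Least[of y "\<lambda>y. y < n \<and> R m y \<noteq> 0"] that k(1) by (auto simp: k_def)
  define a where "a = R m k"
  have RE: "R x y \<in> E (\<beta> y - \<alpha> x)" if "x < n" "y < n" for x y
    using bR that by (auto simp: graded_mat_def)
  have aE: "a \<in> E (\<beta> k - \<alpha> m)" "a \<noteq> 0" using RE k m by (auto simp: a_def)
  have a: "a \<in> carrier Eh" using aE by (auto simp: Eh_carrier_iff)
  let ?a' = "inv\<^bsub>Eh\<^esub> a"
  have a'E: "?a' \<in> E (\<alpha> m - \<beta> k)" using hinv_component[OF aE] by simp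
  define t' where "t' = (\<lambda>x i. if i = m then R x k * ?a' else t x i)"
  define v' where "v' = (\<lambda>i y. if i = m then ?a' * R m y else v i y)"
  \<comment> \<open>A Schur complement: it clears row \<open>m\<close> and column \<open>k\<close>,
    and it leaves the earlier rows and pivot columns zero because \<open>R\<close> vanishes
    there.\<close>
  define R' where "R' = (\<lambda>x y. R x y - R x k * ?a' * R m y)"
  have tE: "R x k * ?a' \<in> E (\<alpha> m - \<alpha> x)" if "x < n" for x
    by (rule mult_component'[OF RE a'E]) (use that k in auto)
  have vE: "?a' * R m y \<in> E (\<beta> y - \<beta> k)" if "y < n" for y
    by (rule mult_component'[OF a'E RE]) (use that m in auto)
  have RE': "R' x y \<in> E (\<beta> y - \<alpha> x)" if "x < n" "y < n" for x y
    unfolding R'_def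
    by (intro diff_component RE that mult_component'[OF tE RE]) (use that m in auto)
  have qk: "q i \<noteq> k" if "i < m" for i using bRq k m that by metis
  have "partial_bruhat n \<alpha> \<beta> A (Suc m) t' (u(m := a)) (q(m := k)) v' R'"
    unfolding partial_bruhat_def
  proof (intro conjI)
    show "inj_on (q(m := k)) {..<Suc m}"
      using binj by (auto simp: inj_on_def less_Suc_eq) (use qk in blast)+
    show "\<forall>i<Suc m. t' i i = 1 \<and> (\<forall>x<i. t' x i = 0) \<and> (\<forall>x<n. t' x i \<in> E (\<alpha> i - \<alpha> x))"
      using bt tE a k bR0 m by (auto simp: t'_def less_Suc_eq a_def[symmetric])
    show "\<forall>i<Suc m. v' i ((q(m := k)) i) = 1 \<and> (\<forall>y<(q(m := k)) i. v' i y = 0) \<and>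
        (\<forall>j<i. v' i ((q(m := k)) j) = 0) \<and> (\<forall>y<n. v' i y \<in> E (\<beta> y - \<beta> ((q(m := k)) i)))"
      using bv bq bRq vE a k_least m by (auto simp: v'_def less_Suc_eq a_def[symmetric])
    show "\<forall>x<n. \<forall>y<n. A x y = (\<Sum>i<Suc m. t' x i * (u(m := a)) i * v' i y) + R' x y"
    proof (intro allI impI)
      fix x y assume xy: "x < n" "y < n"
      have "(\<Sum>i<m. t' x i * (u(m := a)) i * v' i y) = (\<Sum>i<m. t x i * u i * v i y)"
        by (rule sum.cong) (auto simp: t'_def v'_def)
      then show "A x y = (\<Sum>i<Suc m. t' x i * (u(m := a)) i * v' i y) + R' x y"
        using bA xy a by (simp add: t'_def v'_def R'_def mult.assoc)
    qed
    show "\<forall>x<Suc m. \<forall>y<n. R' x y = 0"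
      using bR0 k a by (auto simp: R'_def less_Suc_eq a_def[symmetric])
    show "\<forall>i<Suc m. \<forall>x<n. R' x ((q(m := k)) i) = 0"
      using bRq a m by (auto simp: R'_def less_Suc_eq a_def[symmetric] mult.assoc)
  qed (use bq bu k aE RE' in \<open>auto simp: less_Suc_eq graded_mat_def\<close>)
  then show ?thesis by blast
qed

text \<open>The last clause is strictness. It holds because row \<open>i\<close> is taken from a
  remainder that already vanishes in all earlier pivot columns.\<close>

lemma graded_bruhat_exists:
  assumes A: "graded_mat n \<alpha> \<beta> A"
    and Z: "\<And>x y. x < n \<Longrightarrow> y < n \<Longrightarrow> fmul n A Z x y = (if x = y then 1 else 0)"
  shows "\<exists>T u p V. graded_bruhat n \<alpha> \<beta> A T u p V \<and> (\<forall>i<n. \<forall>j<i. V (p i) (p j) = 0)"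
proof -
  have "\<exists>t u q v R. partial_bruhat n \<alpha> \<beta> A m t u q v R" if "m \<le> n" for m
    using that
  proof (induction m)
    case 0
    have "partial_bruhat n \<alpha> \<beta> A 0 t u q v A" for t u q v
      using A by (simp add: partial_bruhat_def)
    then show ?case by blast
  next
    case (Suc m)
    then obtain t u q v R where *: "partial_bruhat n \<alpha> \<beta> A m t u q v R" "m < n" by auto
    moreover have "\<exists>y<n. R m y \<noteq> 0"
      by (rule partial_bruhat_pivot[OF *, of "\<lambda>y. Z y m"]) (use Z * in \<open>auto simp: fmul_def\<close>)
    ultimately show ?case by (rule partial_bruhat_step)
  qed
  then obtain t u q v R where P: "partial_bruhat n \<alpha> \<beta> A n t u q v R" by blast
  note b = P[unfolded partial_bruhat_def]
  define p where "p = (\<lambda>i. if i < n then q i else i)"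
  have p: "p permutes {..<n}"
    by (rule inj_imp_permutes) (use b in \<open>auto simp: p_def inj_on_def\<close>)
  define p' where "p' = Hilbert_Choice.inv p"
  have p': "p' (p i) = i" "p (p' i) = i" for i
    using permutes_inverses[OF p] by (auto simp: p'_def)
  have pq: "p i = q i" if "i < n" for i using that by (simp add: p_def)
  have p'n: "p' i < n" if "i < n" for i
    using that permutes_in_image[OF permutes_inv[OF p], of i] by (simp add: p'_def)
  have qp': "q (p' i) = i" if "i < n" for i using p'(2)[of i] p'n[OF that] by (simp add: p_def)
  \<comment> \<open>The row found in step \<open>i\<close> becomes row \<open>p i\<close>, so that
    its leading 1 lands on the diagonal.\<close>
  define V where "V = (\<lambda>x y. v (p' x) y)"
  have "unilow n t" using b by (auto simp: unilow_def)
  moreover have "uniup n V"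
    using b p'n qp' unfolding uniup_def V_def by metis
  moreover have "A x y = (\<Sum>i<n. t x i * u i * V (p i) y)" if "x < n" "y < n" for x y
    using b that by (simp add: V_def p')
  moreover have "graded_mat n \<alpha> \<alpha> t" using b by (auto simp: graded_mat_def)
  moreover have "graded_mat n \<beta> \<beta> V"
    using b p'n qp' unfolding graded_mat_def V_def by metis
  ultimately have "graded_bruhat n \<alpha> \<beta> A t u p V"
    using b p pq by (simp add: graded_bruhat_def bruhat_def)
  moreover have "V (p i) (p j) = 0" if "i < n" "j < i" for i j
    using b pq[of j] that by (simp add: V_def p')
  ultimately show ?thesis by blast
qed

end


section \<open>Block diagonal matrices\<close>

definition embed :: "nat \<Rightarrow> (nat \<Rightarrow> nat) \<Rightarrow> (nat \<Rightarrow> nat \<Rightarrow> 'e::ring_1) \<Rightarrow> nat \<Rightarrow> nat \<Rightarrow> 'e" where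
  "embed r f X = (\<lambda>x y. if x \<in> f ` {..<r} \<and> y \<in> f ` {..<r}
     then X (inv_into {..<r} f x) (inv_into {..<r} f y) else if x = y then 1 else 0)"

context graded_division_ring
begin

text \<open>All four factors extend by the identity: a strictly increasing \<open>f\<close> respects
  triangular shape, added fixed points keep the sign of the permutation, and the new pivots are
  1.\<close>

lemma hdet_embed:
  assumes X: "hdet r (\<lambda>_. 0) (\<lambda>_. 0) X c"
    and f: "strict_mono_on {..<r} f" and fn: "f ` {..<r} \<subseteq> {..<n}"
  shows "hdet n (\<lambda>_. 0) (\<lambda>_. 0) (embed r f X) c"
proof -
  obtain T u p V where *: "graded_bruhat r (\<lambda>_. 0) (\<lambda>_. 0) X T u p V" and c: "c = bruhat_class r u p"
    using X by (auto simp: hdet_def)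
  note b = *[unfolded graded_bruhat_def bruhat_def graded_mat_def unilow_def uniup_def, simplified]
  define I where "I = f ` {..<r}"
  define g where "g = inv_into {..<r} f"
  have inj: "inj_on f {..<r}" using f by (rule strict_mono_on_imp_inj_on)
  have gf: "g (f i) = i" if "i < r" for i using inj that by (simp add: g_def)
  have fI: "f i \<in> I" if "i < r" for i using that by (simp add: I_def)
  have In: "I \<subseteq> {..<n}" using fn by (simp add: I_def)
  have g_less: "g x < r" and fg: "f (g x) = x" if "x \<in> I" for x
    using that gf by (auto simp: I_def)
  have g_mono: "g x < g y" if "x \<in> I" "y \<in> I" "x < y" for x y
  proof (rule ccontr)
    assume "\<not> g x < g y"
    then have "g y = g x \<or> g y < g x" by auto
    then have "f (g y) \<le> f (g x)"
      using f that g_less by (auto simp: strict_mono_on_def less_imp_le)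
    then show False using that fg by simp
  qed
  have emb: "embed r f Y = (\<lambda>x y. if x \<in> I \<and> y \<in> I then Y (g x) (g y) else if x = y then 1 else 0)"
    for Y :: "nat \<Rightarrow> nat \<Rightarrow> 'b"
    unfolding embed_def I_def g_def ..
  define u' where "u' = (\<lambda>i. if i \<in> I then u (g i) else 1)"
  define p' where "p' = map_permutation {..<r} f p"
  have p: "p permutes {..<r}" using b by simp
  then have pr: "p i < r" if "i < r" for i using that permutes_in_image[of p "{..<r}" i] by auto
  have p'f: "p' (f i) = f (p i)" if "i < r" for i
    unfolding p'_def using inj that by (intro map_permutation_apply) auto
  have p'_perm: "p' permutes I"
    unfolding p'_def I_def using p inj by (intro map_permutation_permutes) (auto simp: bij_betw_def)
  have p'_id: "p' i = i" if "i \<notin> I" for i using permutes_not_in[OF p'_perm that] .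
  have uE: "u i \<in> carrier Eh" if "i < r" for i using graded_bruhat_in_Eh[OF * that] .
  have "unilow n (embed r f T)"
    unfolding unilow_def emb using b g_less g_mono by auto
  moreover have "uniup n (embed r f V)"
    unfolding uniup_def emb using b g_less g_mono by auto
  moreover have "graded_mat n (\<lambda>_. 0) (\<lambda>_. 0) (embed r f T)"
    unfolding graded_mat_def emb using b g_less one_component zero_component by auto
  moreover have "graded_mat n (\<lambda>_. 0) (\<lambda>_. 0) (embed r f V)"
    unfolding graded_mat_def emb using b g_less one_component zero_component by auto
  moreover have "p' permutes {..<n}" using p'_perm In by (rule permutes_subset)
  moreover have "u' i \<noteq> 0 \<and> u' i \<in> E 0" for i
    using b g_less one_component by (auto simp: u'_def)
  moreover have "embed r f X x y = (\<Sum>i<n. embed r f T x i * u' i * embed r f V (p' i) y)"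
    if "x < n" "y < n" for x y
  proof -
    have "(\<Sum>i<n. embed r f T x i * u' i * embed r f V (p' i) y)
        = (\<Sum>i\<in>I. embed r f T x i * u' i * embed r f V (p' i) y)
          + (\<Sum>i\<in>{..<n} - I. embed r f T x i * u' i * embed r f V (p' i) y)"
      using sum.subset_diff[OF In] by (simp add: add.commute)
    also have "(\<Sum>i\<in>I. embed r f T x i * u' i * embed r f V (p' i) y)
        = (\<Sum>i<r. embed r f T x (f i) * u i * embed r f V (f (p i)) y)"
      unfolding I_def by (subst sum.reindex[OF inj]) (auto simp: u'_def p'f gf fI intro!: sum.cong)
    also have "\<dots> = (if x \<in> I \<and> y \<in> I then X (g x) (g y) else 0)"
    proof (cases "x \<in> I \<and> y \<in> I")
      case True
      then show ?thesis using b g_less by (simp add: emb fI gf pr)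
    next
      case False
      then show ?thesis
        by (auto simp: emb fI pr intro!: sum.neutral)
    qed
    also have "(\<Sum>i\<in>{..<n} - I. embed r f T x i * u' i * embed r f V (p' i) y)
        = (\<Sum>i\<in>{..<n} - I. if i = x then (if x = y then 1 else 0) else 0)"
      by (rule sum.cong) (auto simp: emb u'_def p'_id)
    also have "\<dots> = (if x \<notin> I \<and> x = y then 1 else 0)"
      using that by auto
    finally show ?thesis by (auto simp: emb)
  qed
  ultimately have "graded_bruhat n (\<lambda>_. 0) (\<lambda>_. 0) (embed r f X) (embed r f T) u' p' (embed r f V)"
    by (simp add: graded_bruhat_def bruhat_def)
  moreover have "c = bruhat_class n u' p'"
  proof -
    have "finprod Ab (\<lambda>i. cls (u' i)) {..<n} = finprod Ab (\<lambda>i. cls (u' i)) I"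
      by (rule Ab.finprod_mono_neutral_cong_right)
        (use In uE g_less in \<open>auto simp: u'_def Eh.one_closed[simplified]\<close>)
    also have "\<dots> = finprod Ab (\<lambda>i. cls (u' (f i))) {..<r}"
      unfolding I_def
      by (rule Ab.finprod_reindex[OF _ inj]) (use uE gf fI in \<open>auto simp: u'_def\<close>)
    also have "\<dots> = finprod Ab (\<lambda>i. cls (u i)) {..<r}"
      by (rule Ab.finprod_cong') (use uE in \<open>auto simp: u'_def gf fI\<close>)
    finally show ?thesis
      using sign_map_permutation[OF inj p] by (simp add: c bruhat_class_def p'_def)
  qed
  ultimately show ?thesis by (auto simp: hdet_def)
qed

text \<open>The blocks are interleaved: \<open>f l\<close> enumerates the indices of the block \<open>l\<close> in increasing order,
  so that triangular matrices extend to triangular matrices.\<close>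

lemma hdet_block_diagonal:
  fixes b :: "nat \<Rightarrow> nat"
  assumes A: "\<And>x y. x < n \<Longrightarrow> y < n \<Longrightarrow> b x \<noteq> b y \<Longrightarrow> A x y = 0"
    and bk: "\<And>x. x < n \<Longrightarrow> b x < k"
    and f: "\<And>l. l < k \<Longrightarrow> strict_mono_on {..<r l} (f l)"
    and fl: "\<And>l. l < k \<Longrightarrow> f l ` {..<r l} = {i. i < n \<and> b i = l}"
    and c: "\<And>l. l < k \<Longrightarrow> hdet (r l) (\<lambda>_. 0) (\<lambda>_. 0) (\<lambda>i j. A (f l i) (f l j)) (c l)"
  shows "hdet n (\<lambda>_. 0) (\<lambda>_. 0) A (finprod Ab c {..<k})"
proof -
  \<comment> \<open>Partial products: \<open>B m\<close> equals \<open>A\<close> on the blocks below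
    \<open>m\<close> and the identity on the others, so \<open>B (Suc m)\<close> is
    \<open>B m\<close> times the embedded block \<open>m\<close>.\<close>
  define B where "B = (\<lambda>m x y. if b x = b y then if b x < m then A x y else if x = y then 1 else 0 else 0)"
  have "hdet n (\<lambda>_. 0) (\<lambda>_. 0) (B m) (finprod Ab c {..<m})" if "m \<le> k" for m
    using that
  proof (induction m)
    case 0
    have "B 0 = (\<lambda>x y. if x = y then 1 else 0)" by (auto simp: B_def fun_eq_iff)
    then show ?case using hdet_one by simp
  next
    case (Suc m)
    then have m: "m < k" by simp
    define Y where "Y = embed (r m) (f m) (\<lambda>i j. A (f m i) (f m j))"
    have Y: "Y x y = (if b x = m \<and> b y = m then A x y else if x = y then 1 else 0)"
      if "x < n" "y < n" for x y
    proof -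
      have "f m (inv_into {..<r m} (f m) z) = z" if "z < n" "b z = m" for z
        by (rule f_inv_into_f) (use that fl[OF m] in auto)
      then show ?thesis using that fl[OF m] by (auto simp: Y_def embed_def)
    qed
    have "hdet n (\<lambda>_. 0) (\<lambda>_. 0) Y (c m)"
      unfolding Y_def using f[OF m] fl[OF m] by (intro hdet_embed c m) auto
    then have "hdet n (\<lambda>_. 0) (\<lambda>_. 0) (fmul n (B m) Y) (finprod Ab c {..<m} \<otimes>\<^bsub>Ab\<^esub> c m)"
      using Suc by (intro hdet_fmul) auto
    moreover have eq: "fmul n (B m) Y x y = B (Suc m) x y" if "x < n" "y < n" for x y
    proof (cases "b y = m")
      case True
      have "fmul n (B m) Y x y = (\<Sum>z<n. (if x = z then 1 else 0) * (if b x = m then A z y else 0))"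
        unfolding fmul_def using that True by (intro sum.cong) (auto simp: Y B_def)
      then show ?thesis using that True by (simp add: sum_delta_left B_def)
    next
      case False
      have "fmul n (B m) Y x y = (\<Sum>z<n. B m x z * (if z = y then 1 else 0))"
        unfolding fmul_def using that False by (intro sum.cong) (auto simp: Y)
      then show ?thesis using that False by (auto simp: sum_delta_right B_def less_Suc_eq)
    qed
    moreover have "finprod Ab c {..<m} \<otimes>\<^bsub>Ab\<^esub> c m = finprod Ab c {..<Suc m}"
    proof -
      have cl: "c l \<in> carrier Ab" if "l < k" for l using c[OF that] by (rule hdet_in_Ab)
      then have "c \<in> {..<m} \<rightarrow> carrier Ab" "c m \<in> carrier Ab" using m by auto
      then show ?thesis by (simp add: lessThan_Suc Ab.m_comm)
    qed
    ultimately show ?case by (simp add: hdet_cong[OF eq])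
  qed
  moreover have "B k x y = A x y" if "x < n" "y < n" for x y
    using that A bk by (auto simp: B_def)
  ultimately show ?thesis using hdet_cong[of n "B k" A] by blast
qed

end


section \<open>Matrices and the Dieudonne determinant in degree zero\<close>

abbreviation entries :: "'e mat \<Rightarrow> nat \<Rightarrow> nat \<Rightarrow> 'e" where
  "entries A \<equiv> \<lambda>x y. A $$ (x, y)"

lemma index_mult_fmul:
  assumes "A \<in> carrier_mat n n" "B \<in> carrier_mat n n" "x < n" "y < n"
  shows "(A * B) $$ (x, y) = fmul n (entries A) (entries B) x y"
  using assms by (auto simp: fmul_def scalar_prod_def lessThan_atLeast0 intro!: sum.cong)

lemma mat_ring_over_simps [simp]:
  "monoid.mult (mat_ring_over K n) = (*)" "one (mat_ring_over K n) = 1\<^sub>m n"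
  by (simp_all add: mat_ring_over_def ring_mat_simps)

lemma mat_ring_over_carrier:
  "A \<in> carrier (mat_ring_over K n) \<longleftrightarrow> A \<in> carrier_mat n n \<and> (\<forall>x<n. \<forall>y<n. A $$ (x, y) \<in> K)"
  by (fastforce simp: mat_ring_over_def)

lemma perm_matrix_in_carrier_mat [simp]: "perm_matrix n p \<in> carrier_mat n n"
  by (simp add: perm_matrix_def)

lemma dim_perm_matrix [simp]: "dim_row (perm_matrix n p) = n" "dim_col (perm_matrix n p) = n"
  by (simp_all add: perm_matrix_def)

lemma index_perm_matrix [simp]:
  "x < n \<Longrightarrow> y < n \<Longrightarrow> perm_matrix n p $$ (x, y) = (if x = p y then 1 else 0)"
  by (simp add: perm_matrix_def)

lemma fmul_perm_right:
  fixes A :: "nat \<Rightarrow> nat \<Rightarrow> 'e::ring_1"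
  assumes "p permutes {..<n}" "y < n"
  shows "fmul n A (entries (perm_matrix n p)) x y = A x (p y)"
proof -
  have "p y < n" using assms permutes_in_image[of p "{..<n}" y] by auto
  have "fmul n A (entries (perm_matrix n p)) x y = (\<Sum>k<n. A x k * (if k = p y then 1 else 0))"
    unfolding fmul_def using assms by (intro sum.cong) auto
  then show ?thesis using \<open>p y < n\<close> by (simp add: sum_delta_right)
qed

lemma fmul_perm_left:
  fixes A :: "nat \<Rightarrow> nat \<Rightarrow> 'e::ring_1"
  assumes "p permutes {..<n}" "x < n"
  shows "fmul n (entries (perm_matrix n (Hilbert_Choice.inv p))) A x y = A (p x) y"
proof -
  have "p x < n" using assms permutes_in_image[of p "{..<n}" x] by auto
  have "fmul n (entries (perm_matrix n (Hilbert_Choice.inv p))) A x y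
      = (\<Sum>k<n. (if p x = k then 1 else 0) * A k y)"
    unfolding fmul_def using assms permutes_inverses[OF assms(1)]
    by (intro sum.cong) auto
  then show ?thesis using \<open>p x < n\<close> by (simp add: sum_delta_left)
qed

text \<open>Substituting \<open>i = p j\<close> in the sum over the columns of the permutation
  matrix is what introduces the inverse permutation of \<open>bruhat\<close>.\<close>

lemma index_bruhat_product:
  fixes T U V :: "'e::ring_1 mat"
  assumes "T \<in> carrier_mat n n" "U \<in> carrier_mat n n" "V \<in> carrier_mat n n" "diagonal_mat U"
    and p: "p permutes {..<n}" and xy: "x < n" "y < n"
  shows "(T * U * perm_matrix n p * V) $$ (x, y)
    = (\<Sum>i<n. T $$ (x, i) * U $$ (i, i) * V $$ (Hilbert_Choice.inv p i, y))"
proof -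
  have pn: "p i < n" if "i < n" for i using that permutes_in_image[OF p] by auto
  have TUc: "T * U \<in> carrier_mat n n" "T * U * perm_matrix n p \<in> carrier_mat n n"
    using assms by (auto intro!: mult_carrier_mat[where n=n])
  have TU: "(T * U) $$ (x, i) = T $$ (x, i) * U $$ (i, i)" if "i < n" for i
  proof -
    have "(T * U) $$ (x, i) = (\<Sum>k<n. T $$ (x, i) * U $$ (i, i) * (if k = i then 1 else 0))"
      using assms that by (auto simp del: index_mult_mat(1) simp: index_mult_fmul[where n=n] fmul_def diagonal_mat_def intro!: sum.cong)
    then show ?thesis using that by (simp add: sum_delta_right)
  qed
  have "(T * U * perm_matrix n p * V) $$ (x, y)
      = (\<Sum>j<n. (T * U * perm_matrix n p) $$ (x, j) * V $$ (j, y))"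
    using assms TUc by (subst index_mult_fmul[where n=n]) (auto simp: fmul_def)
  also have "\<dots> = (\<Sum>j<n. T $$ (x, p j) * U $$ (p j, p j) * V $$ (j, y))"
  proof (rule sum.cong[OF refl])
    fix j assume "j \<in> {..<n}"
    then have "(T * U * perm_matrix n p) $$ (x, j) = (T * U) $$ (x, p j)"
      using assms TUc by (subst index_mult_fmul[where n=n]) (auto simp: fmul_perm_right[OF p])
    then show "(T * U * perm_matrix n p) $$ (x, j) * V $$ (j, y)
        = T $$ (x, p j) * U $$ (p j, p j) * V $$ (j, y)"
      using TU pn \<open>j \<in> {..<n}\<close> by simp
  qed
  also have "\<dots> = (\<Sum>i<n. T $$ (x, i) * U $$ (i, i) * V $$ (Hilbert_Choice.inv p i, y))"
    using sum.permute[OF p, of "\<lambda>i. T $$ (x, i) * U $$ (i, i) * V $$ (Hilbert_Choice.inv p i, y)"]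
    by (simp add: permutes_inverses[OF p] comp_def)
  finally show ?thesis .
qed

lemma strict_bruhat_imp_bruhat:
  assumes "strict_bruhat K n A T U p V"
  shows "bruhat n (entries A) (entries T) (\<lambda>i. U $$ (i, i)) (Hilbert_Choice.inv p) (entries V)"
proof -
  note s = assms[unfolded strict_bruhat_def]
  have C: "T \<in> carrier_mat n n" "U \<in> carrier_mat n n" "V \<in> carrier_mat n n"
    using s by (auto simp: mat_ring_over_carrier Units_def)
  have "U $$ (i, i) \<noteq> 0" if "i < n" for i
  proof
    assume 0: "U $$ (i, i) = 0"
    obtain W where W: "W \<in> carrier_mat n n" "U * W = 1\<^sub>m n"
      using s by (auto simp: mat_ring_over_carrier Units_def)
    have "U $$ (i, k) = 0" if "k < n" for k
      using s C 0 that \<open>i < n\<close> by (cases "k = i") (auto simp: diagonal_mat_def)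
    then have "(U * W) $$ (i, i) = 0"
      using C(2) W(1) that by (simp del: index_mult_mat(1) add: index_mult_fmul[where n=n] fmul_def)
    then show False using W that by simp
  qed
  moreover have "A $$ (x, y) = (\<Sum>i<n. T $$ (x, i) * U $$ (i, i) * V $$ (Hilbert_Choice.inv p i, y))"
    if "x < n" "y < n" for x y
    using s C index_bruhat_product that by blast
  ultimately show ?thesis
    using s C by (auto simp: bruhat_def unilow_def uniup_def unipotent_lower_def unipotent_upper_def
        upper_triangular_def permutes_inv)
qed

lemma strict_bruhat_unique:
  assumes "strict_bruhat K n A T U p V" "strict_bruhat K' n A T' U' p' V'"
  shows "bruhat_value U p = bruhat_value U' p'"
proof -
  have "Hilbert_Choice.inv p = Hilbert_Choice.inv p'" "\<And>i. i < n \<Longrightarrow> U $$ (i, i) = U' $$ (i, i)"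
    using bruhat_unique[OF assms[THEN strict_bruhat_imp_bruhat]] by auto
  moreover have "p permutes {..<n}" "p' permutes {..<n}" "dim_row U = n" "dim_row U' = n"
    using assms by (auto simp: strict_bruhat_def Units_def mat_ring_over_carrier)
  ultimately have "p = p'" "diag_mat U = diag_mat U'"
    by (metis permutes_inv_inv, simp add: diag_mat_def)
  then show ?thesis by (simp add: bruhat_value_def)
qed

lemma dieudonne_det_eq:
  assumes "strict_bruhat K n A T U p V" "dim_row A = n"
  shows "dieudonne_det K A = ab_class (nonzero_monoid K) (bruhat_value U p)"
  unfolding dieudonne_det_def
proof (rule the_equality)
  show "\<exists>T' U' p' V'. strict_bruhat K (dim_row A) A T' U' p' V' \<and>
      ab_class (nonzero_monoid K) (bruhat_value U p) = ab_class (nonzero_monoid K) (bruhat_value U' p')"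
    using assms by blast
  show "c = ab_class (nonzero_monoid K) (bruhat_value U p)"
    if "\<exists>T' U' p' V'. strict_bruhat K (dim_row A) A T' U' p' V' \<and>
      c = ab_class (nonzero_monoid K) (bruhat_value U' p')" for c
    using that strict_bruhat_unique assms by metis
qed

context graded_division_ring
begin

lemma cls_prod_list:
  assumes "\<And>i. i < n \<Longrightarrow> u i \<in> carrier Eh"
  shows "prod_list (map u [0..<n]) \<in> carrier Eh \<and>
    cls (prod_list (map u [0..<n])) = finprod Ab (\<lambda>i. cls (u i)) {..<n}"
  using assms
proof (induction n)
  case 0
  then show ?case using Eh.one_closed by simp
next
  case (Suc n)
  then show ?case
    using Eh.m_closed[of "prod_list (map u [0..<n])" "u n"]
    by (simp add: cls_mult lessThan_Suc Pi_iff Ab.m_comm)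
qed

lemma cls_bruhat_value:
  assumes "\<And>i. i < n \<Longrightarrow> U $$ (i, i) \<in> carrier Eh" "dim_row U = n" "p permutes {..<n}"
  shows "cls (bruhat_value U p) = bruhat_class n (\<lambda>i. U $$ (i, i)) (Hilbert_Choice.inv p)"
  using cls_prod_list[of n "\<lambda>i. U $$ (i, i)"] assms
  by (simp add: bruhat_value_def bruhat_class_def diag_mat_def cls_mult sign_inverse
      permutes_imp_permutation[OF finite_lessThan])

text \<open>\<open>K\<close> is arbitrary. For \<open>UNIV\<close> the homogeneity of the pivots is
  not given; it follows by comparison with a homogeneous decomposition.\<close>

lemma hdet_strict_bruhat:
  assumes "hdet n \<alpha> \<beta> (entries A) c" "strict_bruhat K n A T U p V"
  shows "c = cls (bruhat_value U p)"
proof -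
  have "p permutes {..<n}" "dim_row U = n"
    using assms(2) by (auto simp: strict_bruhat_def Units_def mat_ring_over_carrier)
  then show ?thesis
    using hdet_bruhat[OF assms(1) strict_bruhat_imp_bruhat[OF assms(2)]] cls_bruhat_value[of n U p]
    by simp
qed

section \<open>The degree zero units and the induced map of abelianizations\<close>

abbreviation "E0 \<equiv> nonzero_monoid (E 0)"

lemma E0_simps [simp]: "monoid.mult E0 = (*)" "one E0 = 1" "carrier E0 = E 0 - {0}"
  by (simp_all add: nonzero_monoid_def)

lemma subgroup_E0: "subgroup (E 0 - {0}) Eh"
proof (rule Eh.subgroupI)
  show "E 0 - {0} \<subseteq> carrier Eh" by (auto simp: Eh_carrier_iff)
  show "E 0 - {0} \<noteq> {}" using one_component by force
  show "inv\<^bsub>Eh\<^esub> x \<in> E 0 - {0}" if "x \<in> E 0 - {0}" for x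
    using that hinv_component[of x 0] hinv(3)[of x] homogeneous_in_Eh[of x 0] by auto
  show "x \<otimes>\<^bsub>Eh\<^esub> y \<in> E 0 - {0}" if "x \<in> E 0 - {0}" "y \<in> E 0 - {0}" for x y
    using that mult_homogeneous_nonzero[of x 0 y] mult_component[of x 0 y 0] by auto
qed

lemma E0_eq: "E0 = Eh\<lparr>carrier := E 0 - {0}\<rparr>"
  by (simp add: homog_units_def nonzero_monoid_def)

sublocale E0: group E0
  unfolding E0_eq by (rule Eh.subgroup_imp_group[OF subgroup_E0])

sublocale Ab0: comm_group "abelianization E0"
  by (rule E0.comm_group_abelianization)

lemma E0_in_Eh: "x \<in> carrier E0 \<Longrightarrow> x \<in> carrier Eh"
  by (auto simp: Eh_carrier_iff)

text \<open>The derived subgroup of \<open>E0\<close> lies in that of \<open>Eh\<close>, so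
  \<open>cls\<close> is constant on the coset. The coset contains \<open>x\<close>, so its image is
  a singleton and \<open>the_elem\<close> is meaningful.\<close>

lemma ab_map_inclusion:
  assumes "x \<in> carrier E0"
  shows "ab_map Eh (\<lambda>x. x) (ab_class E0 x) = cls x"
proof -
  have sub: "derived E0 (carrier E0) \<subseteq> derived Eh (carrier Eh)"
    unfolding E0_eq using Eh.derived_consistent[OF _ subgroup_E0, of "E 0 - {0}"]
      Eh.mono_derived[OF subgroup.subset[OF subgroup_E0]] by simp
  have "cls (h * x) = cls x" if h: "h \<in> derived E0 (carrier E0)" for h
  proof -
    interpret D: normal "derived Eh (carrier Eh)" Eh by (rule Eh.derived_self_is_normal)
    have "h \<in> derived Eh (carrier Eh)" using sub h by blast
    then have "h \<in> carrier Eh" "cls h = \<one>\<^bsub>Ab\<^esub>"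
      using D.subset Eh.coset_join2[OF _ D.is_subgroup]
      by (auto simp: ab_class_def abelianization_def FactGroup_def)
    then show ?thesis using cls_mult[of h x] E0_in_Eh[OF assms] by simp
  qed
  moreover have "ab_class E0 x = (\<lambda>h. h * x) ` derived E0 (carrier E0)"
    by (auto simp: ab_class_def r_coset_def)
  moreover have "1 \<in> derived E0 (carrier E0)"
    using subgroup.one_closed[OF E0.derived_is_subgroup[of "carrier E0"]] by simp
  ultimately have "(\<lambda>x. cls x) ` ab_class E0 x = {cls x}"
    by (force simp: image_image)
  then show ?thesis by (simp add: ab_map_def)
qed

text \<open>Both products are classes of one common element \<open>y\<close> of \<open>E0\<close>,
  built by induction; this reduces the claim to \<open>ab_map_inclusion\<close>.\<close>

lemma ab_map_finprod:
  assumes "\<And>l. l < k \<Longrightarrow> x l \<in> carrier E0"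
  shows "ab_map Eh (\<lambda>x. x) (finprod (abelianization E0) (\<lambda>l. ab_class E0 (x l)) {..<k})
    = finprod Ab (\<lambda>l. cls (x l)) {..<(k::nat)}"
proof -
  have "\<exists>y\<in>carrier E0. finprod (abelianization E0) (\<lambda>l. ab_class E0 (x l)) {..<k} = ab_class E0 y
      \<and> finprod Ab (\<lambda>l. cls (x l)) {..<k} = cls y"
    using assms
  proof (induction k)
    case 0
    have "ab_class E0 1 = \<one>\<^bsub>abelianization E0\<^esub>"
      using hom_one[OF E0.ab_class_hom E0.is_group Ab0.is_group] by simp
    then show ?case using E0.one_closed by (intro bexI[of _ 1]) auto
  next
    case (Suc k)
    then obtain y where y: "y \<in> carrier E0"
        "finprod (abelianization E0) (\<lambda>l. ab_class E0 (x l)) {..<k} = ab_class E0 y"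
        "finprod Ab (\<lambda>l. cls (x l)) {..<k} = cls y"
      by auto
    have xk: "x k \<in> carrier E0" using Suc.prems by blast
    have cl0: "ab_class E0 (x l) \<in> carrier (abelianization E0)" if "l < Suc k" for l
      using hom_in_carrier[OF E0.ab_class_hom Suc.prems[OF that]] .
    have cl: "cls (x l) \<in> carrier Ab" if "l < Suc k" for l
      using E0_in_Eh[OF Suc.prems[OF that]] by simp
    have "finprod (abelianization E0) (\<lambda>l. ab_class E0 (x l)) {..<Suc k} = ab_class E0 (x k * y)"
      using cl0 y hom_mult[OF E0.ab_class_hom xk y(1)] by (simp add: lessThan_Suc Pi_iff)
    moreover have "finprod Ab (\<lambda>l. cls (x l)) {..<Suc k} = cls (x k * y)"
      using cl y cls_mult[OF E0_in_Eh[OF xk] E0_in_Eh[OF y(1)]] by (simp add: lessThan_Suc Pi_iff)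
    moreover have "x k * y \<in> carrier E0" using E0.m_closed[OF xk y(1)] by simp
    ultimately show ?case by blast
  qed
  then show ?thesis using ab_map_inclusion by metis
qed

text \<open>Lets \<open>inv_char\<close> evaluate the inverse of the permutation matrix that occurs
  in \<open>strict_bruhat\<close>.\<close>

lemma monoid_mat_ring_over_E0: "monoid (mat_ring_over (E 0) n)"
proof (rule monoidI)
  show "A \<otimes>\<^bsub>mat_ring_over (E 0) n\<^esub> B \<in> carrier (mat_ring_over (E 0) n)"
    if "A \<in> carrier (mat_ring_over (E 0) n)" "B \<in> carrier (mat_ring_over (E 0) n)" for A B
    using that
    by (auto simp del: index_mult_mat(1) simp: mat_ring_over_carrier index_mult_fmul[where n=n] fmul_def intro!: sum_component mult_component'[of _ 0 _ 0])
qed (auto simp: mat_ring_over_carrier one_component zero_component)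

text \<open>One decomposition serves both determinants: \<open>bruhat_value U p\<close> represents
  the Dieudonne determinant over \<open>E 0\<close> as well as the value in \<open>Ab\<close>. This
  is the diagram for a single block.\<close>

lemma strict_bruhat_E0_exists:
  assumes A: "A \<in> carrier_mat n n" "graded_mat n (\<lambda>_. 0) (\<lambda>_. 0) (entries A)"
    and Z: "\<And>x y. x < n \<Longrightarrow> y < n \<Longrightarrow> fmul n (entries A) Z x y = (if x = y then 1 else 0)"
  obtains T U p V where "strict_bruhat (E 0) n A T U p V" "bruhat_value U p \<in> carrier E0"
    "hdet n (\<lambda>_. 0) (\<lambda>_. 0) (entries A) (cls (bruhat_value U p))"
proof -
  obtain T u q V where *: "graded_bruhat n (\<lambda>_. 0) (\<lambda>_. 0) (entries A) T u q V"
      and strict: "\<And>i j. i < n \<Longrightarrow> j < i \<Longrightarrow> V (q i) (q j) = 0"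
    using graded_bruhat_exists[OF A(2) Z] by metis
  note b = *[unfolded graded_bruhat_def bruhat_def graded_mat_def, simplified]
  interpret R: monoid "mat_ring_over (E 0) n" by (rule monoid_mat_ring_over_E0)
  define p where "p = Hilbert_Choice.inv q"
  have q: "q permutes {..<n}" using b by simp
  have p: "p permutes {..<n}" unfolding p_def by (rule permutes_inv[OF q])
  have inv_p: "Hilbert_Choice.inv p = q" unfolding p_def by (rule permutes_inv_inv[OF q])
  have qn: "q i < n" if "i < n" for i using that permutes_in_image[OF q] by auto
  define T' where "T' = mat n n (\<lambda>(x, y). T x y)"
  define U where "U = mat n n (\<lambda>(x, y). if x = y then u x else 0)"
  define V' where "V' = mat n n (\<lambda>(x, y). V x y)"
  have C: "T' \<in> carrier_mat n n" "U \<in> carrier_mat n n" "V' \<in> carrier_mat n n"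
    by (auto simp: T'_def U_def V'_def)
  have diag: "diagonal_mat U" by (auto simp: diagonal_mat_def U_def)
  have uE: "u i \<in> carrier Eh" if "i < n" for i using graded_bruhat_in_Eh[OF * that] .
  have perm: "perm_matrix n s \<in> carrier (mat_ring_over (E 0) n)" for s
    by (auto simp: mat_ring_over_carrier one_component zero_component)
  have U_unit: "U \<in> Units (mat_ring_over (E 0) n)"
  proof -
    define W where "W = mat n n (\<lambda>(x, y). if x = y then inv\<^bsub>Eh\<^esub> (u x) else 0)"
    have W: "W \<in> carrier_mat n n" by (simp add: W_def)
    have "U * W = 1\<^sub>m n"
    proof (rule eq_matI)
      fix x y assume "x < dim_row (1\<^sub>m n)" "y < dim_col (1\<^sub>m n)"
      then have xy: "x < n" "y < n" by auto
      have "(U * W) $$ (x, y) = (\<Sum>k<n. (if x = k then 1 else 0) * (u x * W $$ (x, y)))"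
        using xy C W by (auto simp del: index_mult_mat(1) simp: index_mult_fmul[where n=n] fmul_def U_def intro!: sum.cong)
      then show "(U * W) $$ (x, y) = 1\<^sub>m n $$ (x, y)"
        using xy uE by (simp add: sum_delta_left W_def)
    qed (use C W in auto)
    moreover have "W * U = 1\<^sub>m n"
    proof (rule eq_matI)
      fix x y assume "x < dim_row (1\<^sub>m n)" "y < dim_col (1\<^sub>m n)"
      then have xy: "x < n" "y < n" by auto
      have "(W * U) $$ (x, y) = (\<Sum>k<n. (if x = k then 1 else 0) * (inv\<^bsub>Eh\<^esub> (u x) * U $$ (x, y)))"
        using xy C W by (auto simp del: index_mult_mat(1) simp: index_mult_fmul[where n=n] fmul_def W_def intro!: sum.cong)
      then show "(W * U) $$ (x, y) = 1\<^sub>m n $$ (x, y)"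
        using xy uE by (simp add: sum_delta_left U_def)
    qed (use C W in auto)
    moreover have "inv\<^bsub>Eh\<^esub> (u x) \<in> E 0" if "x < n" for x
      using hinv_component[of "u x" 0] b that by simp
    ultimately show ?thesis
      using b W C by (auto simp: Units_def mat_ring_over_carrier U_def W_def zero_component)
  qed
  have "unipotent_lower T'"
    using b by (auto simp: unipotent_lower_def T'_def unilow_def)
  moreover have "unipotent_upper V'"
    using b by (auto simp: unipotent_upper_def V'_def uniup_def upper_triangular_def)
  moreover have "A = T' * U * perm_matrix n p * V'"
  proof (rule eq_matI)
    fix x y
    assume "x < dim_row (T' * U * perm_matrix n p * V')" "y < dim_col (T' * U * perm_matrix n p * V')"
    then have xy: "x < n" "y < n" using C by auto
    have "(T' * U * perm_matrix n p * V') $$ (x, y)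
        = (\<Sum>i<n. T' $$ (x, i) * U $$ (i, i) * V' $$ (q i, y))"
      using index_bruhat_product[OF C diag p xy] by (simp add: inv_p)
    then show "A $$ (x, y) = (T' * U * perm_matrix n p * V') $$ (x, y)"
      using b xy by (simp add: T'_def U_def V'_def qn)
  qed (use A C in auto)
  moreover have "unipotent_upper (perm_matrix n p * V' * inv\<^bsub>mat_ring_over (E 0) n\<^esub> (perm_matrix n p))"
  proof -
    have one: "perm_matrix n s * perm_matrix n t = (1\<^sub>m n :: 'b mat)"
      if "t permutes {..<n}" "s \<circ> t = id" for s t
    proof (rule eq_matI)
      fix x y assume "x < dim_row (1\<^sub>m n :: 'b mat)" "y < dim_col (1\<^sub>m n :: 'b mat)"
      moreover from this have "t y < n" using permutes_in_image[OF that(1)] by auto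
      moreover have "s (t y) = y" using that(2) by (metis comp_apply id_apply)
      ultimately show "(perm_matrix n s * perm_matrix n t) $$ (x, y) = (1\<^sub>m n :: 'b mat) $$ (x, y)"
        by (simp del: index_mult_mat(1) add: index_mult_fmul[where n=n] fmul_perm_right[OF that(1)])
    qed auto
    have "inv\<^bsub>mat_ring_over (E 0) n\<^esub> (perm_matrix n p) = perm_matrix n q"
      by (rule R.inv_char) (use perm one[OF p] one[OF q] permutes_inv_o[OF q] in \<open>auto simp: p_def\<close>)
    moreover have "(perm_matrix n p * V' * perm_matrix n q) $$ (i, j) = V (q i) (q j)"
      if "i < n" "j < n" for i j
    proof -
      have "(perm_matrix n p * V' * perm_matrix n q) $$ (i, j) = (perm_matrix n p * V') $$ (i, q j)"
        using C that mult_carrier_mat[OF perm_matrix_in_carrier_mat C(3)]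
        by (subst index_mult_fmul[where n=n]) (auto simp: fmul_perm_right[OF q])
      also have "\<dots> = V' $$ (q i, q j)"
        using C that qn by (subst index_mult_fmul[where n=n]) (auto simp: p_def fmul_perm_left[OF q])
      finally show ?thesis using that qn by (simp add: V'_def)
    qed
    ultimately show ?thesis
      using C strict b qn by (auto simp: unipotent_upper_def upper_triangular_def uniup_def)
  qed
  ultimately have sb: "strict_bruhat (E 0) n A T' U p V'"
    using b C U_unit diag p by (auto simp: strict_bruhat_def mat_ring_over_carrier T'_def V'_def)
  have UE0: "U $$ (i, i) \<in> carrier E0" if "i < n" for i using b that by (simp add: U_def)
  have "prod_list (map (\<lambda>i. U $$ (i, i)) [0..<m]) \<in> carrier E0" if "m \<le> n" for m
    using that
  proof (induction m)
    case (Suc m)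
    then show ?case
      using E0.m_closed[of "prod_list (map (\<lambda>i. U $$ (i, i)) [0..<m])" "U $$ (m, m)"] UE0[of m] by simp
  qed (use E0.one_closed in simp)
  moreover have "of_int (sign p) \<in> carrier E0"
    using one_component uminus_component[OF one_component] by (cases p rule: sign_cases) auto
  ultimately have "bruhat_value U p \<in> carrier E0"
    using E0.m_closed[of "of_int (sign p)" "prod_list (map (\<lambda>i. U $$ (i, i)) [0..<n])"] C
    by (simp add: bruhat_value_def diag_mat_def)
  moreover have h: "hdet n (\<lambda>_. 0) (\<lambda>_. 0) (entries A) (bruhat_class n u q)"
    using * by (auto simp: hdet_def)
  ultimately show ?thesis
    using that[OF sb] hdet_strict_bruhat[OF h sb] by simp
qed

end


section \<open>The homomorphism and the diagram\<close>

text \<open>\<open>submatrix\<close> numbers its rows and columns by \<open>pick\<close>, which thus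
  provides the increasing enumerations for \<open>hdet_block_diagonal\<close>.\<close>

lemma strict_mono_on_pick:
  assumes "finite I"
  shows "strict_mono_on {..<card I} (pick I)" "pick I ` {..<card I} = I"
proof -
  show "strict_mono_on {..<card I} (pick I)"
    by (auto simp: strict_mono_on_def pick_mono_le)
  have "pick I ` {..<card I} \<subseteq> I" by (auto intro: pick_in_set_le)
  moreover have "card (pick I ` {..<card I}) = card I"
    using strict_mono_on_imp_inj_on[OF \<open>strict_mono_on {..<card I} (pick I)\<close>] by (simp add: card_image)
  ultimately show "pick I ` {..<card I} = I" using assms by (intro card_subset_eq)
qed

lemma homog_GL_simps:
  "monoid.mult (homog_GL E n \<delta>) = (*)"
  "A \<in> carrier (homog_GL E n \<delta>) \<longleftrightarrow>
     A \<in> Units (mat_ring_over UNIV n) \<and> (\<exists>\<gamma>. A \<in> shifted_component E n \<delta> \<gamma>)"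
  by (auto simp: homog_GL_def units_of_def)

context graded_division_ring
begin

lemma shifted_component_graded_mat:
  "A \<in> shifted_component E n \<delta> \<gamma> \<longleftrightarrow>
     A \<in> carrier_mat n n \<and> graded_mat n \<delta> (\<lambda>i. \<gamma> + \<delta> i) (entries A)"
  by (auto simp: shifted_component_def graded_mat_def)

text \<open>Only differences of shifts enter. This makes homogeneous matrices composable: a left
  factor of degree \<gamma> ends at \<gamma> + \<delta>, so the right factor is moved to start
  there.\<close>

lemma hdet_shift:
  "hdet n \<alpha> \<beta> A c \<Longrightarrow> hdet n (\<lambda>i. \<gamma> + \<alpha> i) (\<lambda>i. \<gamma> + \<beta> i) A c"
  unfolding hdet_def graded_bruhat_def graded_mat_def by simp

lemma hdet_exists:
  assumes "graded_mat n \<alpha> \<beta> (entries A)" "A \<in> carrier_mat n n" "B \<in> carrier_mat n n" "A * B = 1\<^sub>m n"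
  shows "\<exists>c. hdet n \<alpha> \<beta> (entries A) c"
proof -
  have "fmul n (entries A) (entries B) x y = (if x = y then 1 else 0)" if "x < n" "y < n" for x y
    using index_mult_fmul[OF assms(2,3) that] assms(4) that by simp
  then show ?thesis
    using graded_bruhat_exists[OF assms(1), of "entries B"] by (auto simp: hdet_def)
qed

lemma homog_GL_hdet:
  assumes "A \<in> carrier (homog_GL E n \<delta>)"
  obtains \<gamma> c where "hdet n \<delta> (\<lambda>i. \<gamma> + \<delta> i) (entries A) c" "A \<in> carrier_mat n n"
proof -
  obtain \<gamma> B where "graded_mat n \<delta> (\<lambda>i. \<gamma> + \<delta> i) (entries A)" "A \<in> carrier_mat n n"
      "B \<in> carrier_mat n n" "A * B = 1\<^sub>m n"
    using assms
    by (auto simp: homog_GL_simps shifted_component_graded_mat Units_def mat_ring_over_carrier)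
  then show ?thesis using hdet_exists that by blast
qed

text \<open>The description ranges over all shifts, so one function covers every degree;
  \<open>hdet_unique\<close> makes it well defined.\<close>

definition det_h :: "nat \<Rightarrow> 'b mat \<Rightarrow> 'b set" where
  "det_h n A = (THE c. \<exists>\<alpha> \<beta>. hdet n \<alpha> \<beta> (entries A) c)"

lemma det_h_eq:
  assumes "hdet n \<alpha> \<beta> (entries A) c"
  shows "det_h n A = c"
  unfolding det_h_def
proof (rule the_equality)
  show "\<exists>\<alpha> \<beta>. hdet n \<alpha> \<beta> (entries A) c" using assms by blast
  show "d = c" if d: "\<exists>\<alpha> \<beta>. hdet n \<alpha> \<beta> (entries A) d" for d
  proof -
    obtain \<alpha>' \<beta>' where "hdet n \<alpha>' \<beta>' (entries A) d" using d by blast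
    then show ?thesis using assms by (rule hdet_unique)
  qed
qed

lemma det_h_hom: "det_h n \<in> hom (homog_GL E n \<delta>) Ab"
proof (rule homI)
  fix A assume A: "A \<in> carrier (homog_GL E n \<delta>)"
  then obtain \<gamma> c where c: "hdet n \<delta> (\<lambda>i. \<gamma> + \<delta> i) (entries A) c" "A \<in> carrier_mat n n"
    by (rule homog_GL_hdet)
  then show "det_h n A \<in> carrier Ab" using det_h_eq hdet_in_Ab by metis
  fix B assume "B \<in> carrier (homog_GL E n \<delta>)"
  then obtain \<eta> d where d: "hdet n \<delta> (\<lambda>i. \<eta> + \<delta> i) (entries B) d" "B \<in> carrier_mat n n"
    by (rule homog_GL_hdet)
  have "hdet n \<delta> (\<lambda>i. \<gamma> + (\<eta> + \<delta> i)) (fmul n (entries A) (entries B)) (c \<otimes>\<^bsub>Ab\<^esub> d)"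
    using hdet_fmul[OF c(1) hdet_shift[OF d(1)]] .
  then have "hdet n \<delta> (\<lambda>i. \<gamma> + (\<eta> + \<delta> i)) (entries (A * B)) (c \<otimes>\<^bsub>Ab\<^esub> d)"
    using hdet_cong[of n "entries (A * B)", OF index_mult_fmul[OF c(2) d(2)]] by blast
  then show "det_h n (A \<otimes>\<^bsub>homog_GL E n \<delta>\<^esub> B) = det_h n A \<otimes>\<^bsub>Ab\<^esub> det_h n B"
    using det_h_eq[OF c(1)] det_h_eq[OF d(1)] by (simp add: homog_GL_simps det_h_eq)
qed

lemma det_h_strict_bruhat:
  assumes "A \<in> carrier (homog_GL E n \<delta>)" "strict_bruhat K n A T U \<pi> V"
  shows "det_h n A = cls (bruhat_value U \<pi>)"
proof -
  obtain \<gamma> c where c: "hdet n \<delta> (\<lambda>i. \<gamma> + \<delta> i) (entries A) c"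
    using homog_GL_hdet[OF assms(1)] .
  show ?thesis using det_h_eq[OF c] hdet_strict_bruhat[OF c assms(2)] by simp
qed

section \<open>Reduction of the degree zero part to blocks\<close>

lemma grade_support_iff: "\<gamma> \<in> grade_support E \<longleftrightarrow> (\<exists>x\<in>E \<gamma>. x \<noteq> 0)"
  using zero_component[of \<gamma>] by (auto simp: grade_support_def)

lemma grade_support_add:
  "\<gamma> \<in> grade_support E \<Longrightarrow> \<eta> \<in> grade_support E \<Longrightarrow> \<gamma> + \<eta> \<in> grade_support E"
  unfolding grade_support_iff using mult_component mult_homogeneous_nonzero by blast

lemma grade_support_uminus: "\<gamma> \<in> grade_support E \<Longrightarrow> - \<gamma> \<in> grade_support E"
  unfolding grade_support_iff using hinv_component hinv(3) homogeneous_in_Eh by blast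

lemma grade_coset_eqI:
  assumes "\<eta> - \<gamma> \<in> grade_support E"
  shows "grade_coset E \<gamma> = grade_coset E \<eta>"
proof -
  have "grade_coset E \<eta> \<subseteq> grade_coset E \<gamma>" if "\<eta> - \<gamma> \<in> grade_support E" for \<eta> \<gamma>
  proof
    fix x assume "x \<in> grade_coset E \<eta>"
    then obtain \<zeta> where "\<zeta> \<in> grade_support E" "x = \<eta> + \<zeta>" by (auto simp: grade_coset_def)
    then have "(\<eta> - \<gamma>) + \<zeta> \<in> grade_support E" "x = \<gamma> + ((\<eta> - \<gamma>) + \<zeta>)"
      using that grade_support_add by auto
    then show "x \<in> grade_coset E \<gamma>" unfolding grade_coset_def by blast
  qed
  moreover have "\<gamma> - \<eta> \<in> grade_support E" using grade_support_uminus[OF assms] by simp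
  ultimately show ?thesis using assms by blast
qed

text \<open>Right multiplication by \<open>diag(w)\<close> is a product with a matrix of known
  class, obtained from \<open>hdet_one\<close>; the left factor contributes the inverse class, and
  the two cancel in \<open>Ab\<close>.\<close>

lemma hdet_conj_diag:
  assumes A: "hdet n \<delta> \<delta> A c" and w: "\<And>i. i < n \<Longrightarrow> w i \<noteq> 0 \<and> w i \<in> E (\<beta> i - \<delta> i)"
  shows "hdet n \<beta> \<beta> (\<lambda>x y. inv\<^bsub>Eh\<^esub> (w x) * A x y * w y) c"
proof -
  have wE: "w i \<in> carrier Eh" if "i < n" for i using w[OF that] by (auto simp: Eh_carrier_iff)
  let ?W = "finprod Ab (\<lambda>i. cls (w i)) {..<n}"
  let ?W' = "finprod Ab (\<lambda>i. cls (inv\<^bsub>Eh\<^esub> (w i))) {..<n}"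
  have W: "?W \<in> carrier Ab" "?W' \<in> carrier Ab" using wE by auto
  have "hdet n \<delta> \<beta> (\<lambda>x y. w x * (if x = y then 1 else 0)) (?W \<otimes>\<^bsub>Ab\<^esub> \<one>\<^bsub>Ab\<^esub>)"
    by (rule hdet_diag[OF hdet_one]) (use w in auto)
  then have "hdet n \<delta> \<beta> (\<lambda>x y. w x * (if x = y then 1 else 0)) ?W"
    using W by simp
  then have "hdet n \<delta> \<beta> (fmul n A (\<lambda>x y. w x * (if x = y then 1 else 0))) (c \<otimes>\<^bsub>Ab\<^esub> ?W)"
    by (rule hdet_fmul[OF A])
  then have "hdet n \<beta> \<beta> (\<lambda>x y. inv\<^bsub>Eh\<^esub> (w x) * fmul n A (\<lambda>x y. w x * (if x = y then 1 else 0)) x y)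
      (?W' \<otimes>\<^bsub>Ab\<^esub> (c \<otimes>\<^bsub>Ab\<^esub> ?W))"
    by (rule hdet_diag) (use w hinv_component[of "w i" "\<beta> i - \<delta> i" for i] wE in auto)
  moreover have "inv\<^bsub>Eh\<^esub> (w x) * fmul n A (\<lambda>x y. w x * (if x = y then 1 else 0)) x y
      = inv\<^bsub>Eh\<^esub> (w x) * A x y * w y" if "x < n" "y < n" for x y
    using that sum_delta_right[of y n "\<lambda>k. A x k * w k"] by (simp add: fmul_def mult.assoc)
  moreover have "?W' \<otimes>\<^bsub>Ab\<^esub> (c \<otimes>\<^bsub>Ab\<^esub> ?W) = c"
  proof -
    have "finprod Ab (\<lambda>i. cls (w i) \<otimes>\<^bsub>Ab\<^esub> cls (inv\<^bsub>Eh\<^esub> (w i))) {..<n} = \<one>\<^bsub>Ab\<^esub>"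
      by (rule Ab.finprod_one_eqI) (use wE in \<open>simp flip: cls_mult\<close>)
    then have "?W \<otimes>\<^bsub>Ab\<^esub> ?W' = \<one>\<^bsub>Ab\<^esub>"
      using wE by (subst (asm) Ab.finprod_multf) auto
    moreover have "?W' \<otimes>\<^bsub>Ab\<^esub> (c \<otimes>\<^bsub>Ab\<^esub> ?W) = c \<otimes>\<^bsub>Ab\<^esub> (?W \<otimes>\<^bsub>Ab\<^esub> ?W')"
      using W hdet_in_Ab[OF A] by (simp add: Ab.m_ac)
    ultimately show ?thesis using hdet_in_Ab[OF A] by simp
  qed
  ultimately show ?thesis
    using hdet_cong[of n "\<lambda>x y. inv\<^bsub>Eh\<^esub> (w x) * fmul n A (\<lambda>x y. w x * (if x = y then 1 else 0)) x y"
        "\<lambda>x y. inv\<^bsub>Eh\<^esub> (w x) * A x y * w y"] by simp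
qed

lemma ab_map_det_zero:
  assumes w: "block_choice E n \<delta> k \<epsilon> w" and A: "A \<in> Units (degree_zero_ring E n \<delta>)"
  shows "ab_map Eh (\<lambda>x. x) (det_zero E n \<delta> k \<epsilon> w A) = det_h n A"
proof -
  obtain B where B: "B \<in> carrier_mat n n" "A * B = 1\<^sub>m n"
      and AC: "A \<in> carrier_mat n n" and gA: "graded_mat n \<delta> \<delta> (entries A)"
    using A by (auto simp: Units_def degree_zero_ring_def shifted_component_graded_mat)
  obtain c where c: "hdet n \<delta> \<delta> (entries A) c"
    using hdet_exists[OF gA AC B] by blast
  note bc = w[unfolded block_choice_def]
  have "\<forall>i. \<exists>l. i < n \<longrightarrow> l < k \<and> grade_coset E (\<epsilon> l) = grade_coset E (\<delta> i)"
  proof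
    fix i
    have "grade_coset E (\<delta> i) \<in> (\<lambda>l. grade_coset E (\<epsilon> l)) ` {..<k}" if "i < n" using bc that by auto
    then show "\<exists>l. i < n \<longrightarrow> l < k \<and> grade_coset E (\<epsilon> l) = grade_coset E (\<delta> i)"
      by (cases "i < n") fastforce+
  qed
  then obtain b where b: "\<And>i. i < n \<Longrightarrow> b i < k \<and> grade_coset E (\<epsilon> (b i)) = grade_coset E (\<delta> i)"
    by metis
  have coset_inj: "l = l'" if "l < k" "l' < k" "grade_coset E (\<epsilon> l) = grade_coset E (\<epsilon> l')" for l l'
    using bc that by (auto simp: inj_on_def)
  define I where "I = (\<lambda>l. index_block E n \<delta> (\<epsilon> l))"
  have I: "I l = {i. i < n \<and> b i = l}" if "l < k" for l
    unfolding I_def index_block_def using b that coset_inj by metis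
  have finI: "finite (I l)" for l by (simp add: I_def index_block_def)
  \<comment> \<open>Constant on each block, so after the conjugation all entries within a block have
    degree 0.\<close>
  define \<beta> where "\<beta> = (\<lambda>i. \<epsilon> (b i))"
  have w: "w i \<noteq> 0 \<and> w i \<in> E (\<beta> i - \<delta> i)" if "i < n" for i
    using bc b[OF that] I[of "b i"] that unfolding I_def \<beta>_def by auto
  have wE: "w i \<in> carrier Eh" if "i < n" for i using w[OF that] by (auto simp: Eh_carrier_iff)
  define A' where "A' = (\<lambda>x y. inv\<^bsub>Eh\<^esub> (w x) * A $$ (x, y) * w y)"
  \<comment> \<open>The conjugated inverse of \<open>A\<close>; its diagonal blocks are right
    inverses of the blocks of \<open>A'\<close>.\<close>
  define B' where "B' = (\<lambda>x y. inv\<^bsub>Eh\<^esub> (w x) * B $$ (x, y) * w y)"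
  have A': "hdet n \<beta> \<beta> A' c"
    unfolding A'_def by (rule hdet_conj_diag[OF c w])
  have A'E: "A' x y \<in> E (\<beta> y - \<beta> x)" if "x < n" "y < n" for x y
  proof -
    have "inv\<^bsub>Eh\<^esub> (w x) * A $$ (x, y) \<in> E (\<delta> y - \<beta> x)"
      by (rule mult_component'[OF hinv_component[of _ "\<beta> x - \<delta> x"], of _ _ "\<delta> y - \<delta> x"])
        (use w that gA in \<open>auto simp: graded_mat_def\<close>)
    then show ?thesis
      unfolding A'_def by (rule mult_component'[of _ _ _ "\<beta> y - \<delta> y"]) (use w that in auto)
  qed
  \<comment> \<open>A nonzero entry would have its degree in the support and thereby identify the
    cosets of two different blocks.\<close>
  have A'0: "A' x y = 0" if "x < n" "y < n" "b x \<noteq> b y" for x y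
  proof (rule ccontr)
    assume "A' x y \<noteq> 0"
    then have "grade_coset E (\<beta> x) = grade_coset E (\<beta> y)"
      using A'E that by (intro grade_coset_eqI) (auto simp: grade_support_iff)
    then show False using coset_inj b that unfolding \<beta>_def by blast
  qed
  have A'B': "fmul n A' B' x y = (if x = y then 1 else 0)" if "x < n" "y < n" for x y
  proof -
    have "fmul n A' B' x y = inv\<^bsub>Eh\<^esub> (w x) * fmul n (entries A) (entries B) x y * w y"
      using wE by (auto simp: fmul_def A'_def B'_def sum_distrib_left sum_distrib_right mult.assoc
          intro!: sum.cong)
    moreover have "fmul n (entries A) (entries B) x y = (if x = y then 1 else 0)"
      using index_mult_fmul[OF AC B(1) that] B(2) that by simp
    ultimately show ?thesis using that wE by simp
  qed
  define f where "f = (\<lambda>l. pick (I l))"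
  define r where "r = (\<lambda>l. card (I l))"
  have f_mono: "strict_mono_on {..<r l} (f l)" for l
    unfolding f_def r_def by (rule strict_mono_on_pick[OF finI])
  have f_img: "f l ` {..<r l} = I l" for l
    unfolding f_def r_def by (rule strict_mono_on_pick[OF finI])
  have f_in: "f l i < n" "b (f l i) = l" if "l < k" "i < r l" for l i
  proof -
    have "f l i \<in> I l" using f_img[of l] that by blast
    then show "f l i < n" "b (f l i) = l" using I that by auto
  qed
  define X where "X = (\<lambda>l. block_matrix E n \<delta> w A (\<epsilon> l))"
  have card_I: "card {i. i < n \<and> i \<in> I l} = r l" for l
    unfolding r_def by (rule arg_cong[where f = card]) (auto simp: I_def index_block_def)
  have XC: "X l \<in> carrier_mat (r l) (r l)" for l
    using card_I[of l] by (simp add: X_def block_matrix_def I_def dim_submatrix carrier_matI)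
  have X: "X l $$ (i, j) = A' (f l i) (f l j)" if "l < k" "i < r l" "j < r l" for l i j
    using that f_in card_I[of l] unfolding X_def block_matrix_def
    by (subst submatrix_index) (auto simp: A'_def f_def I_def)
  have "\<exists>x\<in>carrier E0. dieudonne_det (E 0) (X l) = ab_class E0 x \<and>
      hdet (r l) (\<lambda>_. 0) (\<lambda>_. 0) (\<lambda>i j. A' (f l i) (f l j)) (cls x)" if l: "l < k" for l
  proof -
    have "graded_mat (r l) (\<lambda>_. 0) (\<lambda>_. 0) (entries (X l))"
      unfolding graded_mat_def
    proof (intro allI impI)
      fix i j assume ij: "i < r l" "j < r l"
      then show "X l $$ (i, j) \<in> E (0 - 0)"
        using X[OF l ij] A'E[of "f l i" "f l j"] f_in[OF l] by (simp add: \<beta>_def)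
    qed
    moreover have "fmul (r l) (entries (X l)) (\<lambda>i j. B' (f l i) (f l j)) x y = (if x = y then 1 else 0)"
      if "x < r l" "y < r l" for x y
    proof -
      have "fmul (r l) (entries (X l)) (\<lambda>i j. B' (f l i) (f l j)) x y
          = (\<Sum>k<r l. A' (f l x) (f l k) * B' (f l k) (f l y))"
        unfolding fmul_def using X[OF l] that by simp
      also have "\<dots> = (\<Sum>k\<in>I l. A' (f l x) k * B' k (f l y))"
        unfolding f_img[symmetric]
        by (subst sum.reindex[OF strict_mono_on_imp_inj_on[OF f_mono]]) simp
      \<comment> \<open>Row \<open>f l x\<close> of \<open>A'\<close> is zero outside block
        \<open>l\<close>, so the sum extends to all indices.\<close>
      also have "\<dots> = fmul n A' B' (f l x) (f l y)"
        unfolding fmul_def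
        by (rule sum.mono_neutral_left) (use I[OF l] A'0 f_in[OF l] that in auto)
      also have "\<dots> = (if f l x = f l y then 1 else 0)" using A'B' f_in[OF l] that by simp
      also have "(f l x = f l y) = (x = y)"
        using strict_mono_on_imp_inj_on[OF f_mono[of l]] that by (auto simp: inj_on_def)
      finally show ?thesis .
    qed
    ultimately obtain T U p V where *: "strict_bruhat (E 0) (r l) (X l) T U p V"
        "bruhat_value U p \<in> carrier E0"
        "hdet (r l) (\<lambda>_. 0) (\<lambda>_. 0) (entries (X l)) (cls (bruhat_value U p))"
      by (rule strict_bruhat_E0_exists[OF XC])
    have "hdet (r l) (\<lambda>_. 0) (\<lambda>_. 0) (\<lambda>i j. A' (f l i) (f l j)) (cls (bruhat_value U p))"
      using hdet_cong[of "r l" "entries (X l)", OF X[OF l]] *(3) by simp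
    moreover have "dieudonne_det (E 0) (X l) = ab_class E0 (bruhat_value U p)"
      using dieudonne_det_eq[OF *(1)] XC by auto
    ultimately show ?thesis using * by blast
  qed
  then obtain x where x: "\<And>l. l < k \<Longrightarrow> x l \<in> carrier E0"
      "\<And>l. l < k \<Longrightarrow> dieudonne_det (E 0) (X l) = ab_class E0 (x l)"
      "\<And>l. l < k \<Longrightarrow> hdet (r l) (\<lambda>_. 0) (\<lambda>_. 0) (\<lambda>i j. A' (f l i) (f l j)) (cls (x l))"
    by metis
  have "hdet n (\<lambda>_. 0) (\<lambda>_. 0) A' (finprod Ab (\<lambda>l. cls (x l)) {..<k})"
    by (rule hdet_block_diagonal[of n b A' k r f])
      (use A'0 b f_mono f_img I x(3) in auto)
  \<comment> \<open>\<open>A'\<close> has value \<open>c\<close> for the shifts \<beta> and the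
    product as value for the zero shifts; \<open>hdet_unique\<close> compares across different
    shifts.\<close>
  then have "c = finprod Ab (\<lambda>l. cls (x l)) {..<k}"
    using A' hdet_unique by blast
  moreover have "det_zero E n \<delta> k \<epsilon> w A = finprod (abelianization E0) (\<lambda>l. ab_class E0 (x l)) {..<k}"
    unfolding det_zero_def X_def[symmetric]
    by (rule Ab0.finprod_cong')
      (use x X_def hom_in_carrier[OF E0.ab_class_hom] in auto)
  ultimately show ?thesis
    using ab_map_finprod[of k x] x(1) det_h_eq[OF c] by simp
qed

end

theorem theorem1p2:
  fixes E :: "'g::ab_group_add \<Rightarrow> 'e::ring_1 set"
    and n :: nat
    and \<delta> :: "nat \<Rightarrow> 'g"
  assumes "graded_division_ring E"
  shows "\<exists>det_E \<in> hom (homog_GL E n \<delta>) (abelianization (homog_units E)).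
    (\<forall>A \<in> carrier (homog_GL E n \<delta>). \<forall>T U \<pi> V.
       strict_bruhat UNIV n A T U \<pi> V \<longrightarrow>
       det_E A = ab_class (homog_units E) (bruhat_value U \<pi>)) \<and>
    (\<forall>k \<epsilon> w. block_choice E n \<delta> k \<epsilon> w \<longrightarrow>
       (\<forall>A \<in> Units (degree_zero_ring E n \<delta>).
          ab_map (homog_units E) (\<lambda>x. x) (det_zero E n \<delta> k \<epsilon> w A) = det_E A))"
proof -
  interpret graded_division_ring E by (rule assms)
  show ?thesis
    by (intro bexI[of _ "det_h n"] conjI ballI allI impI)
      (simp_all only: det_h_hom det_h_strict_bruhat ab_map_det_zero)
qed

end
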